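(* Let $(\mathcal C_{\mathrm{bulk}},\{\mathcal C_{p_i}\},\{\Phi_i\},\{\Psi_i\},\{L_i\})_{1\le i\le r}$ be a mediated triangle transport datum and fix an ordered pair $(i,j)$ with $1\le i,j\le r$. Then the interaction profunctor $$\mathbb T_{ij}:\mathcal C_{p_i}^{op}\times\mathcal C_{p_j}\to D(\mathrm{Vect}),\qquad \mathbb T_{ij}(X,Y)=\mathbf{R}\mathrm{Hom}_{\mathcal C_{p_j}}(\Psi_j\Phi_i(X),Y),$$ is exact in the source variable in the (contravariant) triangulated sense. In particular, for every $Y\in\mathcal C_{p_j}$ and every distinguished triangle $$X'\to X\to X''\to X'[1]$$ in $\mathcal C_{p_i}$, applying $\Psi_j\Phi_i$ and then $\mathbf{R}\mathrm{Hom}_{\mathcal C_{p_j}}(-,Y)$ produces a distinguished triangle $$\mathbb T_{ij}(X'',Y)\to\mathbb T_{ij}(X,Y)\to\mathbb T_{ij}(X',Y)\to\mathbb T_{ij}(X'',Y)[1]$$ in $D(\mathrm{Vect})$, and hence a long exact sequence $$\cdots\to H^m(\mathbb T_{ij}(X'',Y))\to H^m(\mathbb T_{ij}(X,Y))\to H^m(\mathbb T_{ij}(X',Y))\to H^{m+1}(\mathbb T_{ij}(X'',Y))\to\cdots.$$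
   Context: Fix a field $k$. $D(\mathrm{Vect})$ is the derived category of complexes of $k$-vector spaces. All triangulated categories are $k$-linear, in a setting where derived Hom objects are defined in $D(\mathrm{Vect})$: each localized category $\mathcal C$ below carries a bifunctor $\mathbf{R}\mathrm{Hom}_{\mathcal C}(-,-):\mathcal C^{op}\times\mathcal C\to D(\mathrm{Vect})$ with $H^m(\mathbf{R}\mathrm{Hom}_{\mathcal C}(X,Y))\cong\mathrm{Hom}_{\mathcal C}(X,Y[m])$ naturally, and such that, for each $Y$, the contravariant functor $\mathbf{R}\mathrm{Hom}_{\mathcal C}(-,Y)$ sends distinguished triangles to distinguished triangles with the order reversed (the connecting morphism being the standard one, up to the usual sign convention). A mediated triangle transport (MTT) datum for a finite node set $\Sigma=\{p_1,\dots,p_r\}$ consists of: a bulk triangulated category $\mathcal C_{\mathrm{bulk}}$; localized triangulated categories $\mathcal C_{p_i}$, $1\le i\le r$; exact (triangulated) functors $\Phi_i:\mathcal C_{p_i}\to\mathcal C_{\mathrm{bulk}}$ and $\Psi_i:\mathcal C_{\mathrm{bulk}}\to\mathcal C_{p_i}$; distinguished objects ("localized probes") $L_i\in\mathcal C_{p_i}$; and a compatibility of these with a "shadow" package, which plays no role in the present statement. The bifunctors $\mathbb T_{ij}$, contravariant in $X\in\mathcal C_{p_i}$ and covariant in $Y\in\mathcal C_{p_j}$, are called the derived interaction profunctors of the datum. *)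

theory Defs
  imports "HOL-Algebra.Module" "HOL-Algebra.AbelCoset" "HOL-Library.FuncSet"
begin

section \<open>Categories, shifts and exact functors\<close>

text \<open>An arrow determines its source and target. Composition \<open>g \<cdot> f\<close> is in the usual order
  (first \<open>f\<close>) and is only meaningful when the target of \<open>f\<close> is the source of \<open>g\<close>.\<close>

record ('o, 'm) category =
  obs  :: "'o set"
  arrs :: "'m set"
  src  :: "'m \<Rightarrow> 'o"
  tgt  :: "'m \<Rightarrow> 'o"
  ide  :: "'o \<Rightarrow> 'm"
  cmp  :: "'m \<Rightarrow> 'm \<Rightarrow> 'm"  (infixl "\<cdot>\<index>" 70)

text \<open>\<open>shO\<close>, \<open>shM\<close> are the shift \<open>[1]\<close> on objects and arrows. A triangle
  \<open>X \<rightarrow> Y \<rightarrow> Z \<rightarrow> X[1]\<close> is recorded by its three arrows.\<close>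

record ('o, 'm) tri_category = "('o, 'm) category" +
  shO  :: "'o \<Rightarrow> 'o"
  shM  :: "'m \<Rightarrow> 'm"
  dist :: "('m \<times> 'm \<times> 'm) set"

definition Hom :: "('o, 'm, 'x) category_scheme \<Rightarrow> 'o \<Rightarrow> 'o \<Rightarrow> 'm set" where
  "Hom C X Y = {f \<in> arrs C. src C f = X \<and> tgt C f = Y}"

definition isos :: "('o, 'm, 'x) category_scheme \<Rightarrow> 'o \<Rightarrow> 'o \<Rightarrow> 'm set" where
  "isos C X Y = {f \<in> Hom C X Y. \<exists>g \<in> Hom C Y X. g \<cdot>\<^bsub>C\<^esub> f = ide C X \<and> f \<cdot>\<^bsub>C\<^esub> g = ide C Y}"

definition triangles :: "('o, 'm, 'x) tri_category_scheme \<Rightarrow> ('m \<times> 'm \<times> 'm) set" where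
  "triangles C = {(f, g, h). \<exists>X \<in> obs C. \<exists>Y \<in> obs C. \<exists>Z \<in> obs C.
     f \<in> Hom C X Y \<and> g \<in> Hom C Y Z \<and> h \<in> Hom C Z (shO C X)}"

definition tri_isomorphic ::
    "('o, 'm, 'x) tri_category_scheme \<Rightarrow> 'm \<times> 'm \<times> 'm \<Rightarrow> 'm \<times> 'm \<times> 'm \<Rightarrow> bool" where
  "tri_isomorphic C = (\<lambda>(f, g, h) (f', g', h').
     \<exists>u \<in> isos C (src C f) (src C f'). \<exists>v \<in> isos C (src C g) (src C g').
     \<exists>w \<in> isos C (src C h) (src C h').
       v \<cdot>\<^bsub>C\<^esub> f = f' \<cdot>\<^bsub>C\<^esub> u \<and> w \<cdot>\<^bsub>C\<^esub> g = g' \<cdot>\<^bsub>C\<^esub> v \<and> shM C u \<cdot>\<^bsub>C\<^esub> h = h' \<cdot>\<^bsub>C\<^esub> w)"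

text \<open>A functor together with its comparison with the shifts: \<open>shiso F X : F(X[1]) \<rightarrow> (F X)[1]\<close> in
  the covariant case, \<open>shiso F X : F X \<rightarrow> (F(X[1]))[1]\<close> in the contravariant case.\<close>

record ('o, 'm, 'o2, 'm2) tri_functor =
  onO   :: "'o \<Rightarrow> 'o2"
  onM   :: "'m \<Rightarrow> 'm2"
  shiso :: "'o \<Rightarrow> 'm2"

text \<open>Additivity is not listed in the next two definitions since it follows: a functor commuting
  with the shifts and preserving distinguished triangles preserves zero objects and biproducts.
  In particular no addition on the Hom sets is needed to speak of exactness.\<close>

definition exact_functor ::
    "('o, 'm, 'x) tri_category_scheme \<Rightarrow> ('o2, 'm2, 'y) tri_category_scheme
      \<Rightarrow> ('o, 'm, 'o2, 'm2) tri_functor \<Rightarrow> bool" where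
  "exact_functor C D F \<longleftrightarrow>
     (\<forall>X \<in> obs C. onO F X \<in> obs D) \<and>
     (\<forall>X \<in> obs C. \<forall>Y \<in> obs C. \<forall>f \<in> Hom C X Y. onM F f \<in> Hom D (onO F X) (onO F Y)) \<and>
     (\<forall>X \<in> obs C. onM F (ide C X) = ide D (onO F X)) \<and>
     (\<forall>X \<in> obs C. \<forall>Y \<in> obs C. \<forall>Z \<in> obs C. \<forall>f \<in> Hom C X Y. \<forall>g \<in> Hom C Y Z.
        onM F (g \<cdot>\<^bsub>C\<^esub> f) = onM F g \<cdot>\<^bsub>D\<^esub> onM F f) \<and>
     (\<forall>X \<in> obs C. shiso F X \<in> isos D (onO F (shO C X)) (shO D (onO F X))) \<and>
     (\<forall>X \<in> obs C. \<forall>Y \<in> obs C. \<forall>f \<in> Hom C X Y.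
        shiso F Y \<cdot>\<^bsub>D\<^esub> onM F (shM C f) = shM D (onM F f) \<cdot>\<^bsub>D\<^esub> shiso F X) \<and>
     (\<forall>f g h. (f, g, h) \<in> dist C \<longrightarrow>
        (onM F f, onM F g, shiso F (src C f) \<cdot>\<^bsub>D\<^esub> onM F h) \<in> dist D)"

text \<open>Contravariant case: \<open>X' \<rightarrow> X \<rightarrow> X'' \<rightarrow> X'[1]\<close> goes to \<open>F X'' \<rightarrow> F X \<rightarrow> F X' \<rightarrow> (F X'')[1]\<close>, whose
  connecting arrow is \<open>F X' \<rightarrow> (F(X'[1]))[1] \<rightarrow> (F X'')[1]\<close>, the first map being \<open>shiso F X'\<close>, which
  absorbs the sign convention, and the second one \<open>(F h)[1]\<close>.\<close>

definition contra_exact_functor ::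
    "('o, 'm, 'x) tri_category_scheme \<Rightarrow> ('o2, 'm2, 'y) tri_category_scheme
      \<Rightarrow> ('o, 'm, 'o2, 'm2) tri_functor \<Rightarrow> bool" where
  "contra_exact_functor C D F \<longleftrightarrow>
     (\<forall>X \<in> obs C. onO F X \<in> obs D) \<and>
     (\<forall>X \<in> obs C. \<forall>Y \<in> obs C. \<forall>f \<in> Hom C X Y. onM F f \<in> Hom D (onO F Y) (onO F X)) \<and>
     (\<forall>X \<in> obs C. onM F (ide C X) = ide D (onO F X)) \<and>
     (\<forall>X \<in> obs C. \<forall>Y \<in> obs C. \<forall>Z \<in> obs C. \<forall>f \<in> Hom C X Y. \<forall>g \<in> Hom C Y Z.
        onM F (g \<cdot>\<^bsub>C\<^esub> f) = onM F f \<cdot>\<^bsub>D\<^esub> onM F g) \<and>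
     (\<forall>X \<in> obs C. shiso F X \<in> isos D (onO F X) (shO D (onO F (shO C X)))) \<and>
     (\<forall>X \<in> obs C. \<forall>Y \<in> obs C. \<forall>f \<in> Hom C X Y.
        shM D (onM F (shM C f)) \<cdot>\<^bsub>D\<^esub> shiso F Y = shiso F X \<cdot>\<^bsub>D\<^esub> onM F f) \<and>
     (\<forall>f g h. (f, g, h) \<in> dist C \<longrightarrow>
        (onM F g, onM F f, shM D (onM F h) \<cdot>\<^bsub>D\<^esub> shiso F (src C f)) \<in> dist D)"

definition tri_comp ::
    "('o3, 'm3, 'x) tri_category_scheme \<Rightarrow> ('o2, 'm2, 'o3, 'm3) tri_functor
      \<Rightarrow> ('o, 'm, 'o2, 'm2) tri_functor \<Rightarrow> ('o, 'm, 'o3, 'm3) tri_functor" where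
  "tri_comp E G F =
     \<lparr>onO = (\<lambda>X. onO G (onO F X)), onM = (\<lambda>f. onM G (onM F f)),
      shiso = (\<lambda>X. shiso G (onO F X) \<cdot>\<^bsub>E\<^esub> onM G (shiso F X))\<rparr>"


section \<open>k-linear triangulated categories\<close>

record ('k, 'o, 'm) lin_category = "('o, 'm) tri_category" +
  hadd   :: "'m \<Rightarrow> 'm \<Rightarrow> 'm"
  hzero  :: "'o \<Rightarrow> 'o \<Rightarrow> 'm"
  hsmult :: "'k \<Rightarrow> 'm \<Rightarrow> 'm"

definition hom_module :: "('k, 'o, 'm, 'x) lin_category_scheme \<Rightarrow> 'o \<Rightarrow> 'o \<Rightarrow> ('k, 'm) module" where
  "hom_module C X Y =
     \<lparr>carrier = Hom C X Y, mult = undefined, one = undefined,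
      zero = hzero C X Y, add = hadd C, smult = hsmult C\<rparr>"

definition linear_maps ::
    "'k ring \<Rightarrow> ('k, 'v, 'x) module_scheme \<Rightarrow> ('k, 'w, 'y) module_scheme \<Rightarrow> ('v \<Rightarrow> 'w) set" where
  "linear_maps K V W = {f. f \<in> carrier V \<rightarrow> carrier W \<and>
     (\<forall>x \<in> carrier V. \<forall>y \<in> carrier V. f (x \<oplus>\<^bsub>V\<^esub> y) = f x \<oplus>\<^bsub>W\<^esub> f y) \<and>
     (\<forall>a \<in> carrier K. \<forall>x \<in> carrier V. f (a \<odot>\<^bsub>V\<^esub> x) = a \<odot>\<^bsub>W\<^esub> f x)}"

definition zero_object :: "('k, 'o, 'm, 'x) lin_category_scheme \<Rightarrow> 'o \<Rightarrow> bool" where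
  "zero_object C Z \<longleftrightarrow> Z \<in> obs C \<and>
     (\<forall>X \<in> obs C. Hom C X Z = {hzero C X Z} \<and> Hom C Z X = {hzero C Z X})"

locale lin_additive_category =
  fixes K :: "'k ring" and C :: "('k, 'o, 'm, 'x) lin_category_scheme" (structure)
  assumes field: "field K"
    and src_tgt: "f \<in> arrs C \<Longrightarrow> src C f \<in> obs C \<and> tgt C f \<in> obs C"
    and ide_hom: "X \<in> obs C \<Longrightarrow> ide C X \<in> Hom C X X"
    and cmp_hom: "\<lbrakk>f \<in> Hom C X Y; g \<in> Hom C Y Z\<rbrakk> \<Longrightarrow> g \<cdot> f \<in> Hom C X Z"
    and cmp_ide: "f \<in> Hom C X Y \<Longrightarrow> f \<cdot> ide C X = f \<and> ide C Y \<cdot> f = f"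
    and cmp_assoc: "\<lbrakk>f \<in> Hom C W X; g \<in> Hom C X Y; h \<in> Hom C Y Z\<rbrakk> \<Longrightarrow> h \<cdot> (g \<cdot> f) = (h \<cdot> g) \<cdot> f"
    and hom_vector_space: "\<lbrakk>X \<in> obs C; Y \<in> obs C\<rbrakk> \<Longrightarrow> module K (hom_module C X Y)"
    and cmp_linear_right: "\<lbrakk>X \<in> obs C; g \<in> Hom C Y Z\<rbrakk> \<Longrightarrow>
          (\<lambda>f. g \<cdot> f) \<in> linear_maps K (hom_module C X Y) (hom_module C X Z)"
    and cmp_linear_left: "\<lbrakk>Z \<in> obs C; f \<in> Hom C X Y\<rbrakk> \<Longrightarrow>
          (\<lambda>g. g \<cdot> f) \<in> linear_maps K (hom_module C Y Z) (hom_module C X Z)"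
    and ex_zero: "\<exists>Z. zero_object C Z"
    and ex_biproduct: "\<lbrakk>X \<in> obs C; Y \<in> obs C\<rbrakk> \<Longrightarrow>
          \<exists>S \<in> obs C. \<exists>i \<in> Hom C X S. \<exists>j \<in> Hom C Y S. \<exists>p \<in> Hom C S X. \<exists>q \<in> Hom C S Y.
            p \<cdot> i = ide C X \<and> q \<cdot> j = ide C Y \<and> q \<cdot> i = hzero C X Y \<and> p \<cdot> j = hzero C Y X \<and>
            hadd C (i \<cdot> p) (j \<cdot> q) = ide C S"

text \<open>The shift is an automorphism of the category, so that \<open>[m]\<close> makes sense for every
  integer \<open>m\<close> (see \<open>shO_pow\<close> and \<open>shM_pow\<close> below).\<close>

locale lin_triangulated_category = lin_additive_category +
  assumes shO_bij: "bij_betw (shO C) (obs C) (obs C)"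
    and shM_bij: "bij_betw (shM C) (arrs C) (arrs C)"
    and shM_hom: "f \<in> Hom C X Y \<Longrightarrow> shM C f \<in> Hom C (shO C X) (shO C Y)"
    and shM_ide: "X \<in> obs C \<Longrightarrow> shM C (ide C X) = ide C (shO C X)"
    and shM_cmp: "\<lbrakk>f \<in> Hom C X Y; g \<in> Hom C Y Z\<rbrakk> \<Longrightarrow> shM C (g \<cdot> f) = shM C g \<cdot> shM C f"
    and shM_linear: "\<lbrakk>X \<in> obs C; Y \<in> obs C\<rbrakk> \<Longrightarrow>
          shM C \<in> linear_maps K (hom_module C X Y) (hom_module C (shO C X) (shO C Y))"
    and dist_triangles: "dist C \<subseteq> triangles C"
    and TR1_iso: "\<lbrakk>t \<in> dist C; t' \<in> triangles C; tri_isomorphic C t t'\<rbrakk> \<Longrightarrow> t' \<in> dist C"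
    and TR1_ide: "\<lbrakk>X \<in> obs C; zero_object C Z\<rbrakk> \<Longrightarrow>
          (ide C X, hzero C X Z, hzero C Z (shO C X)) \<in> dist C"
    and TR1_ex: "f \<in> arrs C \<Longrightarrow> \<exists>g h. (f, g, h) \<in> dist C"
    and TR2: "\<lbrakk>(f, g, h) \<in> triangles C; f \<in> Hom C X Y\<rbrakk> \<Longrightarrow>
          (f, g, h) \<in> dist C \<longleftrightarrow>
          (g, h, \<ominus>\<^bsub>hom_module C (shO C X) (shO C Y)\<^esub> (shM C f)) \<in> dist C"
    and TR3: "\<lbrakk>(f, g, h) \<in> dist C; (f', g', h') \<in> dist C;
          u \<in> Hom C (src C f) (src C f'); v \<in> Hom C (src C g) (src C g'); v \<cdot> f = f' \<cdot> u\<rbrakk> \<Longrightarrow>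
          \<exists>w \<in> Hom C (src C h) (src C h'). w \<cdot> g = g' \<cdot> v \<and> shM C u \<cdot> h = h' \<cdot> w"
    and TR4: "\<lbrakk>f \<in> Hom C X Y; g \<in> Hom C Y Z;
          (f, a, b) \<in> dist C; (g, c, d) \<in> dist C; (g \<cdot> f, e, h) \<in> dist C\<rbrakk> \<Longrightarrow>
          \<exists>u \<in> Hom C (tgt C a) (tgt C e). \<exists>v \<in> Hom C (tgt C e) (tgt C c).
            u \<cdot> a = e \<cdot> g \<and> h \<cdot> u = b \<and> v \<cdot> e = c \<and> d \<cdot> v = shM C f \<cdot> h \<and>
            (u, v, shM C a \<cdot> d) \<in> dist C"

definition shO_pow :: "('o, 'm, 'x) tri_category_scheme \<Rightarrow> int \<Rightarrow> 'o \<Rightarrow> 'o" where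
  "shO_pow C m = (if 0 \<le> m then shO C ^^ nat m else inv_into (obs C) (shO C) ^^ nat (- m))"

definition shM_pow :: "('o, 'm, 'x) tri_category_scheme \<Rightarrow> int \<Rightarrow> 'm \<Rightarrow> 'm" where
  "shM_pow C m = (if 0 \<le> m then shM C ^^ nat m else inv_into (arrs C) (shM C) ^^ nat (- m))"


section \<open>Complexes of vector spaces\<close>

record ('k, 'v) cochain =
  cx   :: "int \<Rightarrow> ('k, 'v) module"
  diff :: "int \<Rightarrow> 'v \<Rightarrow> 'v"

definition is_complex :: "'k ring \<Rightarrow> ('k, 'v) cochain \<Rightarrow> bool" where
  "is_complex K X \<longleftrightarrow> (\<forall>n. module K (cx X n) \<and>
     diff X n \<in> linear_maps K (cx X n) (cx X (n + 1)) \<and>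
     (\<forall>x \<in> carrier (cx X n). diff X (n + 1) (diff X n x) = \<zero>\<^bsub>cx X (n + 2)\<^esub>))"

text \<open>The components are required to be extensional, so that chain maps which agree on the
  underlying spaces are equal.\<close>

definition chain_maps ::
    "'k ring \<Rightarrow> ('k, 'v) cochain \<Rightarrow> ('k, 'v) cochain \<Rightarrow> (int \<Rightarrow> 'v \<Rightarrow> 'v) set" where
  "chain_maps K X Y = {\<phi>. \<forall>n. \<phi> n \<in> linear_maps K (cx X n) (cx Y n) \<and>
     \<phi> n \<in> extensional (carrier (cx X n)) \<and>
     (\<forall>x \<in> carrier (cx X n). \<phi> (n + 1) (diff X n x) = diff Y n (\<phi> n x))}"

definition chain_id :: "('k, 'v) cochain \<Rightarrow> int \<Rightarrow> 'v \<Rightarrow> 'v" where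
  "chain_id X n = restrict id (carrier (cx X n))"

definition chain_comp ::
    "('k, 'v) cochain \<Rightarrow> (int \<Rightarrow> 'v \<Rightarrow> 'v) \<Rightarrow> (int \<Rightarrow> 'v \<Rightarrow> 'v) \<Rightarrow> int \<Rightarrow> 'v \<Rightarrow> 'v" where
  "chain_comp X \<psi> \<phi> n = compose (carrier (cx X n)) (\<psi> n) (\<phi> n)"

definition cocycles :: "('k, 'v) cochain \<Rightarrow> int \<Rightarrow> 'v set" where
  "cocycles X m = {x \<in> carrier (cx X m). diff X m x = \<zero>\<^bsub>cx X (m + 1)\<^esub>}"

definition coboundaries :: "('k, 'v) cochain \<Rightarrow> int \<Rightarrow> 'v set" where
  "coboundaries X m = diff X (m - 1) ` carrier (cx X (m - 1))"

text \<open>The quotient space of cocycles by coboundaries; its elements are the cosets.\<close>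

definition cohomology :: "('k, 'v) cochain \<Rightarrow> int \<Rightarrow> ('k, 'v set) module" where
  "cohomology X m =
     \<lparr>carrier = (\<lambda>z. coboundaries X m +>\<^bsub>cx X m\<^esub> z) ` cocycles X m,
      mult = undefined, one = undefined,
      zero = coboundaries X m,
      add = (<+>\<^bsub>cx X m\<^esub>),
      smult = (\<lambda>a S. coboundaries X m <+>\<^bsub>cx X m\<^esub> ((\<lambda>x. a \<odot>\<^bsub>cx X m\<^esub> x) ` S))\<rparr>"

text \<open>The map \<open>[z] \<mapsto> [\<phi> z]\<close> induced by a chain map \<open>\<phi>\<close> with target \<open>Y\<close>.\<close>

definition cohomology_map ::
    "('k, 'v) cochain \<Rightarrow> int \<Rightarrow> (int \<Rightarrow> 'v \<Rightarrow> 'v) \<Rightarrow> 'v set \<Rightarrow> 'v set" where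
  "cohomology_map Y m \<phi> S = coboundaries Y m <+>\<^bsub>cx Y m\<^esub> (\<phi> m ` S)"

definition quasi_isos ::
    "'k ring \<Rightarrow> ('k, 'v) cochain \<Rightarrow> ('k, 'v) cochain \<Rightarrow> (int \<Rightarrow> 'v \<Rightarrow> 'v) set" where
  "quasi_isos K X Y = {s \<in> chain_maps K X Y. \<forall>m.
     bij_betw (cohomology_map Y m s) (carrier (cohomology X m)) (carrier (cohomology Y m))}"

definition cshift :: "('k, 'v) cochain \<Rightarrow> ('k, 'v) cochain" where
  "cshift X = \<lparr>cx = (\<lambda>n. cx X (n + 1)), diff = (\<lambda>n x. \<ominus>\<^bsub>cx X (n + 2)\<^esub> (diff X (n + 1) x))\<rparr>"

definition chain_shift :: "(int \<Rightarrow> 'v \<Rightarrow> 'v) \<Rightarrow> int \<Rightarrow> 'v \<Rightarrow> 'v" where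
  "chain_shift \<phi> n = \<phi> (n + 1)"

text \<open>The vectors of our spaces live in a type that is closed under ordered pairs, so that direct
  sums, and hence mapping cones, are again spaces of the same kind. The type \<open>'u\<close> of atoms is
  arbitrary and plays the role of a universe: only spaces whose vectors are taken from \<open>'u vect\<close>
  occur.\<close>

datatype 'u vect = Atom 'u | Join (jfst: "'u vect") (jsnd: "'u vect")

definition direct_sum :: "('k, 'u vect) module \<Rightarrow> ('k, 'u vect) module \<Rightarrow> ('k, 'u vect) module" where
  "direct_sum V W =
     \<lparr>carrier = {Join x y | x y. x \<in> carrier V \<and> y \<in> carrier W},
      mult = undefined, one = undefined,
      zero = Join \<zero>\<^bsub>V\<^esub> \<zero>\<^bsub>W\<^esub>,
      add = (\<lambda>s t. Join (jfst s \<oplus>\<^bsub>V\<^esub> jfst t) (jsnd s \<oplus>\<^bsub>W\<^esub> jsnd t)),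
      smult = (\<lambda>a s. Join (a \<odot>\<^bsub>V\<^esub> jfst s) (a \<odot>\<^bsub>W\<^esub> jsnd s))\<rparr>"

text \<open>Mapping cone of \<open>\<phi> : X \<rightarrow> Y\<close>: the space \<open>X\<^sup>n\<^sup>+\<^sup>1 \<oplus> Y\<^sup>n\<close> in degree \<open>n\<close>, with differential
  \<open>(x, y) \<mapsto> (- d x, \<phi> x + d y)\<close>.\<close>

definition cone :: "('k, 'u vect) cochain \<Rightarrow> ('k, 'u vect) cochain
    \<Rightarrow> (int \<Rightarrow> 'u vect \<Rightarrow> 'u vect) \<Rightarrow> ('k, 'u vect) cochain" where
  "cone X Y \<phi> =
     \<lparr>cx = (\<lambda>n. direct_sum (cx X (n + 1)) (cx Y n)),
      diff = (\<lambda>n s. Join (\<ominus>\<^bsub>cx X (n + 2)\<^esub> (diff X (n + 1) (jfst s)))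
                        (\<phi> (n + 1) (jfst s) \<oplus>\<^bsub>cx Y (n + 1)\<^esub> diff Y n (jsnd s)))\<rparr>"

definition cone_in :: "('k, 'u vect) cochain \<Rightarrow> ('k, 'u vect) cochain \<Rightarrow> int \<Rightarrow> 'u vect \<Rightarrow> 'u vect" where
  "cone_in X Y n = restrict (\<lambda>y. Join \<zero>\<^bsub>cx X (n + 1)\<^esub> y) (carrier (cx Y n))"

definition cone_out :: "('k, 'u vect) cochain \<Rightarrow> ('k, 'u vect) cochain \<Rightarrow> int \<Rightarrow> 'u vect \<Rightarrow> 'u vect" where
  "cone_out X Y n = restrict jfst (carrier (direct_sum (cx X (n + 1)) (cx Y n)))"


section \<open>The derived category of vector spaces\<close>

text \<open>The localization of the category of complexes at the quasi-isomorphisms, constructed as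
  usual: arrows are zigzags of chain maps (\<open>Fwd\<close>) and formal inverses of quasi-isomorphisms
  (\<open>Bwd X Y s\<close> is the formal inverse of \<open>s : X \<rightarrow> Y\<close>), modulo the congruence generated by
  composition of chain maps and by the two inverse laws. The arrow of a zigzag that is written
  first is applied first.\<close>

datatype ('c, 'f) letter = Fwd 'c 'c 'f | Bwd 'c 'c 'f

type_synonym ('k, 'v) zigzag = "(('k, 'v) cochain, int \<Rightarrow> 'v \<Rightarrow> 'v) letter list"

inductive zigzag ::
    "'k ring \<Rightarrow> ('k, 'v) cochain \<Rightarrow> ('k, 'v) cochain \<Rightarrow> ('k, 'v) zigzag \<Rightarrow> bool" for K where
  "is_complex K X \<Longrightarrow> zigzag K X X []"
| "\<lbrakk>is_complex K X; \<phi> \<in> chain_maps K X Y; zigzag K Y Z w\<rbrakk> \<Longrightarrow> zigzag K X Z (Fwd X Y \<phi> # w)"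
| "\<lbrakk>is_complex K Y; s \<in> quasi_isos K X Y; zigzag K X Z w\<rbrakk> \<Longrightarrow> zigzag K Y Z (Bwd X Y s # w)"

inductive zigzag_eq ::
    "'k ring \<Rightarrow> ('k, 'v) cochain \<Rightarrow> ('k, 'v) cochain \<Rightarrow> ('k, 'v) zigzag \<Rightarrow> ('k, 'v) zigzag \<Rightarrow> bool"
  for K X Y where
  refl:  "zigzag K X Y w \<Longrightarrow> zigzag_eq K X Y w w"
| sym:   "zigzag_eq K X Y w w' \<Longrightarrow> zigzag_eq K X Y w' w"
| trans: "\<lbrakk>zigzag_eq K X Y w w'; zigzag_eq K X Y w' w''\<rbrakk> \<Longrightarrow> zigzag_eq K X Y w w''"
| ident: "\<lbrakk>zigzag K X A u; zigzag K A Y v\<rbrakk> \<Longrightarrow>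
    zigzag_eq K X Y (u @ [Fwd A A (chain_id A)] @ v) (u @ v)"
| comp:  "\<lbrakk>zigzag K X A u; \<phi> \<in> chain_maps K A B; is_complex K B; \<psi> \<in> chain_maps K B C;
    zigzag K C Y v\<rbrakk> \<Longrightarrow>
    zigzag_eq K X Y (u @ [Fwd A B \<phi>, Fwd B C \<psi>] @ v) (u @ [Fwd A C (chain_comp A \<psi> \<phi>)] @ v)"
| inv1:  "\<lbrakk>zigzag K X A u; s \<in> quasi_isos K A B; is_complex K B; zigzag K A Y v\<rbrakk> \<Longrightarrow>
    zigzag_eq K X Y (u @ [Fwd A B s, Bwd A B s] @ v) (u @ v)"
| inv2:  "\<lbrakk>zigzag K X B u; s \<in> quasi_isos K A B; is_complex K A; zigzag K B Y v\<rbrakk> \<Longrightarrow>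
    zigzag_eq K X Y (u @ [Bwd A B s, Fwd A B s] @ v) (u @ v)"

text \<open>An arrow of the derived category: source, target, class of zigzags.\<close>

type_synonym ('k, 'v) darrow =
  "('k, 'v) cochain \<times> ('k, 'v) cochain \<times> ('k, 'v) zigzag set"

definition dclass ::
    "'k ring \<Rightarrow> ('k, 'v) cochain \<Rightarrow> ('k, 'v) cochain \<Rightarrow> ('k, 'v) zigzag \<Rightarrow> ('k, 'v) darrow" where
  "dclass K X Y w = (X, Y, {w'. zigzag_eq K X Y w w'})"

definition dloc :: "'k ring \<Rightarrow> ('k, 'v) cochain \<Rightarrow> ('k, 'v) cochain
    \<Rightarrow> (int \<Rightarrow> 'v \<Rightarrow> 'v) \<Rightarrow> ('k, 'v) darrow" where
  "dloc K X Y \<phi> = dclass K X Y [Fwd X Y \<phi>]"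

definition dcomp :: "'k ring \<Rightarrow> ('k, 'v) darrow \<Rightarrow> ('k, 'v) darrow \<Rightarrow> ('k, 'v) darrow" where
  "dcomp K = (\<lambda>(Y', Z, q) (X, Y, p). (X, Z, {w. \<exists>u \<in> p. \<exists>v \<in> q. zigzag_eq K X Z (u @ v) w}))"

fun letter_shift :: "(('k, 'v) cochain, int \<Rightarrow> 'v \<Rightarrow> 'v) letter
    \<Rightarrow> (('k, 'v) cochain, int \<Rightarrow> 'v \<Rightarrow> 'v) letter" where
  "letter_shift (Fwd X Y \<phi>) = Fwd (cshift X) (cshift Y) (chain_shift \<phi>)"
| "letter_shift (Bwd X Y s) = Bwd (cshift X) (cshift Y) (chain_shift s)"

definition dshift :: "'k ring \<Rightarrow> ('k, 'v) darrow \<Rightarrow> ('k, 'v) darrow" where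
  "dshift K = (\<lambda>(X, Y, p). (cshift X, cshift Y,
     {w. \<exists>u \<in> p. zigzag_eq K (cshift X) (cshift Y) (map letter_shift u) w}))"

definition cone_triangle :: "'k ring \<Rightarrow> ('k, 'u vect) cochain \<Rightarrow> ('k, 'u vect) cochain
    \<Rightarrow> (int \<Rightarrow> 'u vect \<Rightarrow> 'u vect)
    \<Rightarrow> ('k, 'u vect) darrow \<times> ('k, 'u vect) darrow \<times> ('k, 'u vect) darrow" where
  "cone_triangle K X Y \<phi> =
     (dloc K X Y \<phi>, dloc K Y (cone X Y \<phi>) (cone_in X Y), dloc K (cone X Y \<phi>) (cshift X) (cone_out X Y))"

definition DVect_pre ::
    "'k ring \<Rightarrow> (('k, 'u vect) cochain, ('k, 'u vect) darrow) tri_category" where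
  "DVect_pre K =
     \<lparr>obs = {X. is_complex K X},
      arrs = {dclass K X Y w | X Y w. zigzag K X Y w},
      src = fst, tgt = (\<lambda>\<alpha>. fst (snd \<alpha>)),
      ide = (\<lambda>X. dclass K X X []),
      cmp = dcomp K,
      shO = cshift, shM = dshift K,
      dist = {}\<rparr>"

text \<open>Distinguished triangles are those isomorphic, in the derived category, to the triangle of a
  mapping cone; \<open>DVect_pre\<close> is only used to express this isomorphism.\<close>

definition DVect ::
    "'k ring \<Rightarrow> (('k, 'u vect) cochain, ('k, 'u vect) darrow) tri_category" where
  "DVect K = (DVect_pre K)\<lparr>dist :=
     {t \<in> triangles (DVect_pre K). \<exists>X Y \<phi>. is_complex K X \<and> is_complex K Y \<and>
        \<phi> \<in> chain_maps K X Y \<and> tri_isomorphic (DVect_pre K) t (cone_triangle K X Y \<phi>)}\<rparr>"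

fun letter_cohomology ::
    "int \<Rightarrow> (('k, 'v) cochain, int \<Rightarrow> 'v \<Rightarrow> 'v) letter \<Rightarrow> 'v set \<Rightarrow> 'v set" where
  "letter_cohomology m (Fwd X Y \<phi>) = cohomology_map Y m \<phi>"
| "letter_cohomology m (Bwd X Y s) = inv_into (carrier (cohomology X m)) (cohomology_map Y m s)"

definition zigzag_cohomology :: "int \<Rightarrow> ('k, 'v) zigzag \<Rightarrow> 'v set \<Rightarrow> 'v set" where
  "zigzag_cohomology m w = fold (letter_cohomology m) w"

text \<open>Any representing zigzag induces the same map on cohomology classes, so the choice is
  immaterial.\<close>

definition dcohomology :: "int \<Rightarrow> ('k, 'v) darrow \<Rightarrow> 'v set \<Rightarrow> 'v set" where
  "dcohomology m \<alpha> = zigzag_cohomology m (SOME w. w \<in> snd (snd \<alpha>))"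

definition exact_at :: "'k ring \<Rightarrow> ('k, 'v) module \<Rightarrow> ('v \<Rightarrow> 'v)
    \<Rightarrow> ('k, 'v) module \<Rightarrow> ('v \<Rightarrow> 'v) \<Rightarrow> ('k, 'v) module \<Rightarrow> bool" where
  "exact_at K U f V g W \<longleftrightarrow> f \<in> linear_maps K U V \<and> g \<in> linear_maps K V W \<and>
     f ` carrier U = {y \<in> carrier V. g y = \<zero>\<^bsub>W\<^esub>}"

text \<open>Exactness of
  \<open>\<dots> \<rightarrow> H\<^sup>m A \<rightarrow> H\<^sup>m B \<rightarrow> H\<^sup>m C \<rightarrow> H\<^sup>m\<^sup>+\<^sup>1 A \<rightarrow> \<dots>\<close> for \<open>a : A \<rightarrow> B\<close>, \<open>b : B \<rightarrow> C\<close>, \<open>c : C \<rightarrow> A[1]\<close>. On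
  complexes, \<open>H\<^sup>m (A[1])\<close> and \<open>H\<^sup>m\<^sup>+\<^sup>1 A\<close> coincide, as \<open>d\<close> and \<open>- d\<close> have the same kernel and image.\<close>

definition long_exact :: "'k ring \<Rightarrow> ('k, 'v) cochain \<Rightarrow> ('k, 'v) cochain \<Rightarrow> ('k, 'v) cochain
    \<Rightarrow> ('k, 'v) darrow \<Rightarrow> ('k, 'v) darrow \<Rightarrow> ('k, 'v) darrow \<Rightarrow> bool" where
  "long_exact K A B C a b c \<longleftrightarrow> (\<forall>m.
     exact_at K (cohomology A m) (dcohomology m a) (cohomology B m) (dcohomology m b) (cohomology C m) \<and>
     exact_at K (cohomology B m) (dcohomology m b) (cohomology C m) (dcohomology m c) (cohomology A (m + 1)) \<and>
     exact_at K (cohomology C m) (dcohomology m c) (cohomology A (m + 1)) (dcohomology (m + 1) a) (cohomology B (m + 1)))"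


section \<open>Derived Hom\<close>

text \<open>A functor of two variables, contravariant in the first and covariant in the second one,
  with a comparison \<open>proS P X Y : P(X, Y) \<rightarrow> P(X[1], Y)[1]\<close> for shifts of the first variable.\<close>

record ('o, 'm, 'o2, 'm2) profunctor =
  proO :: "'o \<Rightarrow> 'o \<Rightarrow> 'o2"
  proM :: "'m \<Rightarrow> 'm \<Rightarrow> 'm2"
  proS :: "'o \<Rightarrow> 'o \<Rightarrow> 'm2"

definition is_bifunctor ::
    "('o, 'm, 'x) category_scheme \<Rightarrow> ('o, 'm, 'y) category_scheme \<Rightarrow> ('o2, 'm2, 'z) category_scheme
      \<Rightarrow> ('o, 'm, 'o2, 'm2, 'w) profunctor_scheme \<Rightarrow> bool" where
  "is_bifunctor C C' D P \<longleftrightarrow>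
     (\<forall>X \<in> obs C. \<forall>Y \<in> obs C'. proO P X Y \<in> obs D) \<and>
     (\<forall>X \<in> obs C. \<forall>X' \<in> obs C. \<forall>Y \<in> obs C'. \<forall>Y' \<in> obs C'. \<forall>f \<in> Hom C X X'. \<forall>g \<in> Hom C' Y Y'.
        proM P f g \<in> Hom D (proO P X' Y) (proO P X Y')) \<and>
     (\<forall>X \<in> obs C. \<forall>Y \<in> obs C'. proM P (ide C X) (ide C' Y) = ide D (proO P X Y)) \<and>
     (\<forall>X \<in> obs C. \<forall>X' \<in> obs C. \<forall>X'' \<in> obs C. \<forall>Y \<in> obs C'. \<forall>Y' \<in> obs C'. \<forall>Y'' \<in> obs C'.
        \<forall>f \<in> Hom C X X'. \<forall>f' \<in> Hom C X' X''. \<forall>g \<in> Hom C' Y Y'. \<forall>g' \<in> Hom C' Y' Y''.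
        proM P (f' \<cdot>\<^bsub>C\<^esub> f) (g' \<cdot>\<^bsub>C'\<^esub> g) = proM P f g' \<cdot>\<^bsub>D\<^esub> proM P f' g)"

definition at_target ::
    "('o, 'm, 'x) category_scheme \<Rightarrow> ('o, 'm, 'o2, 'm2, 'w) profunctor_scheme \<Rightarrow> 'o
      \<Rightarrow> ('o, 'm, 'o2, 'm2) tri_functor" where
  "at_target C' P Y = \<lparr>onO = (\<lambda>X. proO P X Y), onM = (\<lambda>f. proM P f (ide C' Y)),
     shiso = (\<lambda>X. proS P X Y)\<rparr>"

text \<open>\<open>rhomH R m X Y\<close> is the identification of \<open>H\<^sup>m(RHom(X, Y))\<close> with \<open>Hom(X, Y[m])\<close>.\<close>

record ('k, 'u, 'o, 'm) derived_hom =
    "('o, 'm, ('k, 'u vect) cochain, ('k, 'u vect) darrow) profunctor" +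
  rhomH :: "int \<Rightarrow> 'o \<Rightarrow> 'o \<Rightarrow> 'u vect set \<Rightarrow> 'm"

text \<open>\<open>shift_std\<close> says that the connecting morphism of \<open>RHom(-, Y)\<close> is the standard one: under the
  identification with Hom spaces, the comparison \<open>RHom(X, Y) \<rightarrow> RHom(X[1], Y)[1]\<close> is
  \<open>f \<mapsto> f[1]\<close>, up to a sign depending on the degree only.\<close>

locale derived_hom =
  fixes K :: "'k ring" and C :: "('k, 'o, 'm) lin_category" (structure)
    and R :: "('k, 'u, 'o, 'm) derived_hom"
  assumes bifunctor: "is_bifunctor C C (DVect K) R"
    and rhomH_linear: "\<lbrakk>X \<in> obs C; Y \<in> obs C\<rbrakk> \<Longrightarrow>
          rhomH R m X Y \<in> linear_maps K (cohomology (proO R X Y) m) (hom_module C X (shO_pow C m Y))"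
    and rhomH_bij: "\<lbrakk>X \<in> obs C; Y \<in> obs C\<rbrakk> \<Longrightarrow>
          bij_betw (rhomH R m X Y) (carrier (cohomology (proO R X Y) m)) (Hom C X (shO_pow C m Y))"
    and rhomH_natural: "\<lbrakk>X \<in> obs C; X' \<in> obs C; Y \<in> obs C; Y' \<in> obs C; f \<in> Hom C X' X;
          g \<in> Hom C Y Y'; z \<in> carrier (cohomology (proO R X Y) m)\<rbrakk> \<Longrightarrow>
          rhomH R m X' Y' (dcohomology m (proM R f g) z) = shM_pow C m g \<cdot> rhomH R m X Y z \<cdot> f"
    and exact_source: "Y \<in> obs C \<Longrightarrow> contra_exact_functor C (DVect K) (at_target C R Y)"
    and shift_std: "\<exists>\<epsilon>. (\<forall>m. \<epsilon> m \<in> {\<one>\<^bsub>K\<^esub>, \<ominus>\<^bsub>K\<^esub> \<one>\<^bsub>K\<^esub>}) \<and>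
          (\<forall>X \<in> obs C. \<forall>Y \<in> obs C. \<forall>m. \<forall>z \<in> carrier (cohomology (proO R X Y) m).
             rhomH R (m + 1) (shO C X) Y (dcohomology m (proS R X Y) z) =
             hsmult C (\<epsilon> m) (shM C (rhomH R m X Y z)))"


section \<open>Mediated triangle transport data\<close>

text \<open>The node set is \<open>\<Sigma> = {p 1, \<dots>, p r}\<close>. The localized categories share their types of objects
  and arrows but are otherwise unrelated. The derived Hom objects of the ambient setting are part
  of the datum; the shadow package is not.\<close>

locale mtt_datum =
  fixes K :: "'k ring" and r :: nat and p :: "nat \<Rightarrow> 'p"
    and Bulk :: "('k, 'bo, 'bm) lin_category"
    and Loc :: "'p \<Rightarrow> ('k, 'o, 'm) lin_category"
    and \<Phi> :: "'p \<Rightarrow> ('o, 'm, 'bo, 'bm) tri_functor"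
    and \<Psi> :: "'p \<Rightarrow> ('bo, 'bm, 'o, 'm) tri_functor"
    and L :: "'p \<Rightarrow> 'o"
    and R :: "'p \<Rightarrow> ('k, 'u, 'o, 'm) derived_hom"
  assumes field: "field K"
    and nodes_distinct: "inj_on p {1..r}"
    and bulk: "lin_triangulated_category K Bulk"
    and localized: "i \<in> {1..r} \<Longrightarrow> lin_triangulated_category K (Loc (p i))"
    and rhom: "i \<in> {1..r} \<Longrightarrow> derived_hom K (Loc (p i)) (R (p i))"
    and \<Phi>_exact: "i \<in> {1..r} \<Longrightarrow> exact_functor (Loc (p i)) Bulk (\<Phi> (p i))"
    and \<Psi>_exact: "i \<in> {1..r} \<Longrightarrow> exact_functor Bulk (Loc (p i)) (\<Psi> (p i))"
    and probe: "i \<in> {1..r} \<Longrightarrow> L (p i) \<in> obs (Loc (p i))"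

text \<open>For \<open>G = \<Psi>\<^sub>j \<Phi>\<^sub>i\<close>, the comparison with the shift is
  \<open>RHom(G X, Y) \<rightarrow> RHom((G X)[1], Y)[1] \<rightarrow> RHom(G(X[1]), Y)[1]\<close>, the second map being induced by
  \<open>G(X[1]) \<rightarrow> (G X)[1]\<close>.\<close>

definition interaction ::
    "'k ring \<Rightarrow> ('p \<Rightarrow> ('k, 'o, 'm) lin_category) \<Rightarrow> ('p \<Rightarrow> ('o, 'm, 'bo, 'bm) tri_functor)
      \<Rightarrow> ('p \<Rightarrow> ('bo, 'bm, 'o, 'm) tri_functor) \<Rightarrow> ('p \<Rightarrow> ('k, 'u, 'o, 'm) derived_hom)
      \<Rightarrow> 'p \<Rightarrow> 'p \<Rightarrow> ('o, 'm, ('k, 'u vect) cochain, ('k, 'u vect) darrow) profunctor" where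
  "interaction K Loc \<Phi> \<Psi> R a b =
     (let G = tri_comp (Loc b) (\<Psi> b) (\<Phi> a) in
      \<lparr>proO = (\<lambda>X Y. proO (R b) (onO G X) Y),
       proM = (\<lambda>f g. proM (R b) (onM G f) g),
       proS = (\<lambda>X Y. dcomp K (dshift K (proM (R b) (shiso G X) (ide (Loc b) Y)))
                             (proS (R b) (onO G X) Y))\<rparr>)"

end

theory Submission
  imports Defs
begin

text \<open>\<open>T\<^sub>i\<^sub>j(-, Y)\<close> is the composite of the exact functor \<open>\<Psi>\<^sub>j \<Phi>\<^sub>i\<close> with the contravariant exact functor
  \<open>RHom(-, Y)\<close>; the shift comparisons match by functoriality of the shift and associativity in the
  derived category. The long exact sequence holds for every distinguished triangle of \<open>DVect K\<close>:
  such a triangle is isomorphic to that of a mapping cone, where exactness is a computation with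
  cocycles, and cohomology transports it because it is invariant under the relations between
  zigzags.\<close>

section \<open>Cohomology of complexes\<close>

text \<open>Arrows of the derived category are sets of words, so an arrow can only be handled
  through a representative. Hence the central facts on \<open>zigzag_eq\<close>: it is a congruence
  for concatenation and it is respected by shifting words letter by letter. They turn
  \<open>dcomp\<close> and \<open>dshift\<close> into list append and
  \<open>map letter_shift\<close>. Signs enter through the differentials of \<open>cshift\<close>
  and of the cone, never through \<open>chain_shift\<close>. Negation permutes each space and
  commutes with linear maps, so cocycles and coboundaries of a shifted complex are literally those
  of the original one degree higher. The connecting map on cohomology therefore lands in the right
  space with no identification in between. What remains of the signs is visible in the witnesses
  chosen inside the cone. Cohomology spaces are treated through closure under the operations and a
  few scalar laws; this is all that the arguments on linear maps between them ask for.\<close>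

lemma linear_map_closed:
  "f \<in> linear_maps K V W \<Longrightarrow> x \<in> carrier V \<Longrightarrow> f x \<in> carrier W"
  by (auto simp: linear_maps_def)

lemma linear_map_add:
  "f \<in> linear_maps K V W \<Longrightarrow> x \<in> carrier V \<Longrightarrow> y \<in> carrier V \<Longrightarrow> f (x \<oplus>\<^bsub>V\<^esub> y) = f x \<oplus>\<^bsub>W\<^esub> f y"
  by (auto simp: linear_maps_def)

lemma linear_map_smult:
  "f \<in> linear_maps K V W \<Longrightarrow> a \<in> carrier K \<Longrightarrow> x \<in> carrier V \<Longrightarrow>
    f (a \<odot>\<^bsub>V\<^esub> x) = a \<odot>\<^bsub>W\<^esub> f x"
  by (auto simp: linear_maps_def)

text \<open>Homogeneity gives this: the zero vector is the scalar 0 times itself.\<close>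

lemma linear_map_zero:
  assumes "module K V" "module K W" "f \<in> linear_maps K V W"
  shows "f \<zero>\<^bsub>V\<^esub> = \<zero>\<^bsub>W\<^esub>"
proof -
  interpret V: module K V by fact
  interpret W: module K W by fact
  have "f (\<zero>\<^bsub>K\<^esub> \<odot>\<^bsub>V\<^esub> \<zero>\<^bsub>V\<^esub>) = \<zero>\<^bsub>K\<^esub> \<odot>\<^bsub>W\<^esub> f \<zero>\<^bsub>V\<^esub>"
    by (rule linear_map_smult[OF assms(3)]) auto
  then show ?thesis
    using linear_map_closed[OF assms(3), of "\<zero>\<^bsub>V\<^esub>"] by simp
qed

lemma linear_map_minus:
  assumes "module K V" "module K W" "f \<in> linear_maps K V W" "x \<in> carrier V"
  shows "f (\<ominus>\<^bsub>V\<^esub> x) = \<ominus>\<^bsub>W\<^esub> f x"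
proof -
  interpret V: module K V by fact
  interpret W: module K W by fact
  have "f (\<ominus>\<^bsub>V\<^esub> x) \<oplus>\<^bsub>W\<^esub> f x = f (\<ominus>\<^bsub>V\<^esub> x \<oplus>\<^bsub>V\<^esub> x)"
    using assms by (simp add: linear_map_add)
  also have "\<dots> = \<zero>\<^bsub>W\<^esub>"
    using assms linear_map_zero by (simp add: V.l_neg)
  finally show ?thesis
    using assms by (metis W.minus_equality V.a_inv_closed linear_map_closed)
qed

lemma linear_maps_comp:
  assumes "f \<in> linear_maps K U V" "g \<in> linear_maps K V W"
  shows "(\<lambda>x. g (f x)) \<in> linear_maps K U W"
  using assms by (auto simp: linear_maps_def Pi_iff)

text \<open>Maps on cohomology are controlled on carriers only, so linearity has to be transferred
  along agreement there. Closure is assumed in place of \<open>module\<close> so that the rule also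
  applies to cohomology spaces.\<close>

lemma linear_maps_cong:
  assumes "f \<in> linear_maps K V W" "\<And>x. x \<in> carrier V \<Longrightarrow> f x = f' x"
    and "\<And>x y. x \<in> carrier V \<Longrightarrow> y \<in> carrier V \<Longrightarrow> x \<oplus>\<^bsub>V\<^esub> y \<in> carrier V"
    and "\<And>a x. a \<in> carrier K \<Longrightarrow> x \<in> carrier V \<Longrightarrow> a \<odot>\<^bsub>V\<^esub> x \<in> carrier V"
  shows "f' \<in> linear_maps K V W"
  using assms by (auto simp: linear_maps_def Pi_iff)

text \<open>The map \<open>f\<close> sends the sum (or multiple) of the preimages to the sum (or
  multiple) of the given vectors, and the inverse undoes this. It gives meaning to backward letters
  on cohomology.\<close>

lemma inv_linear_map:
  assumes f: "f \<in> linear_maps K V W" and bij: "bij_betw f (carrier V) (carrier W)"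
    and add: "\<And>x y. x \<in> carrier V \<Longrightarrow> y \<in> carrier V \<Longrightarrow> x \<oplus>\<^bsub>V\<^esub> y \<in> carrier V"
    and smult: "\<And>a x. a \<in> carrier K \<Longrightarrow> x \<in> carrier V \<Longrightarrow> a \<odot>\<^bsub>V\<^esub> x \<in> carrier V"
  shows "inv_into (carrier V) f \<in> linear_maps K W V"
proof -
  let ?g = "inv_into (carrier V) f"
  have inj: "inj_on f (carrier V)" using bij by (rule bij_betw_imp_inj_on)
  have g: "?g y \<in> carrier V" "f (?g y) = y" if "y \<in> carrier W" for y
    using bij that by (auto simp: bij_betw_def inv_into_into f_inv_into_f)
  have gf: "?g (f x) = x" if "x \<in> carrier V" for x
    using inj that by (rule inv_into_f_f)
  have "?g (x \<oplus>\<^bsub>W\<^esub> y) = ?g x \<oplus>\<^bsub>V\<^esub> ?g y" if "x \<in> carrier W" "y \<in> carrier W" for x y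
    using gf[OF add[OF g(1)[OF that(1)] g(1)[OF that(2)]]] linear_map_add[OF f g(1) g(1)] g that
    by simp
  moreover have "?g (a \<odot>\<^bsub>W\<^esub> y) = a \<odot>\<^bsub>V\<^esub> ?g y" if "a \<in> carrier K" "y \<in> carrier W" for a y
    using gf[OF smult[OF that(1) g(1)[OF that(2)]]] linear_map_smult[OF f that(1) g(1)] g that
    by simp
  ultimately show ?thesis
    using g by (auto simp: linear_maps_def)
qed

section \<open>Complexes and chain maps\<close>

lemma complex_module: "is_complex K X \<Longrightarrow> module K (cx X n)"
  by (auto simp: is_complex_def)

lemma complex_diff: "is_complex K X \<Longrightarrow> diff X n \<in> linear_maps K (cx X n) (cx X (n + 1))"
  by (auto simp: is_complex_def)

lemma complex_diff_prev:
  "is_complex K X \<Longrightarrow> diff X (n - 1) \<in> linear_maps K (cx X (n - 1)) (cx X n)"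
  using complex_diff[of K X "n - 1"] by simp

lemma complex_diff_diff:
  "is_complex K X \<Longrightarrow> x \<in> carrier (cx X n) \<Longrightarrow> diff X (n + 1) (diff X n x) = \<zero>\<^bsub>cx X (n + 2)\<^esub>"
  by (auto simp: is_complex_def)

lemma chain_map_linear: "\<phi> \<in> chain_maps K X Y \<Longrightarrow> \<phi> n \<in> linear_maps K (cx X n) (cx Y n)"
  by (auto simp: chain_maps_def)

lemma chain_map_diff:
  "\<phi> \<in> chain_maps K X Y \<Longrightarrow> x \<in> carrier (cx X n) \<Longrightarrow> \<phi> (n + 1) (diff X n x) = diff Y n (\<phi> n x)"
  by (auto simp: chain_maps_def)

lemma chain_id_chain_maps:
  assumes "is_complex K X"
  shows "chain_id X \<in> chain_maps K X X"
proof -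
  have "diff X n x \<in> carrier (cx X (n + 1))" if "x \<in> carrier (cx X n)" for n x
    using complex_diff[OF assms] that by (rule linear_map_closed)
  moreover have "x \<oplus>\<^bsub>cx X n\<^esub> y \<in> carrier (cx X n)"
    if "x \<in> carrier (cx X n)" "y \<in> carrier (cx X n)" for n x y
    using complex_module[OF assms, of n] that
    by (simp add: abelian_monoid.a_closed abelian_group.axioms module_def)
  moreover have "a \<odot>\<^bsub>cx X n\<^esub> x \<in> carrier (cx X n)"
    if "a \<in> carrier K" "x \<in> carrier (cx X n)" for n a x
    using complex_module[OF assms, of n] that by (simp add: module.smult_closed)
  ultimately show ?thesis
    by (auto simp: chain_maps_def chain_id_def linear_maps_def)
qed

lemma chain_comp_chain_maps:
  assumes "is_complex K X" "\<phi> \<in> chain_maps K X Y" "\<psi> \<in> chain_maps K Y Z"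
  shows "chain_comp X \<psi> \<phi> \<in> chain_maps K X Z"
proof -
  have "compose (carrier (cx X n)) (\<psi> n) (\<phi> n) \<in> linear_maps K (cx X n) (cx Z n)" for n
  proof -
    interpret module K "cx X n" by (rule complex_module[OF assms(1)])
    \<comment> \<open>\<open>compose\<close> is cut off outside the carrier, so linearity is
      transferred from the plain composite.\<close>
    show ?thesis
      by (rule linear_maps_cong[OF linear_maps_comp[OF chain_map_linear[OF assms(2)]
            chain_map_linear[OF assms(3)]]]) (auto simp: compose_def)
  qed
  moreover have "compose (carrier (cx X (n + 1))) (\<psi> (n + 1)) (\<phi> (n + 1)) (diff X n x) =
      diff Z n (compose (carrier (cx X n)) (\<psi> n) (\<phi> n) x)" if "x \<in> carrier (cx X n)" for n x
    using that linear_map_closed[OF complex_diff[OF assms(1)] that]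
      linear_map_closed[OF chain_map_linear[OF assms(2)] that]
      chain_map_diff[OF assms(2)] chain_map_diff[OF assms(3)]
    by (simp add: compose_def)
  ultimately show ?thesis
    by (auto simp: chain_maps_def chain_comp_def compose_extensional)
qed

section \<open>Cohomology classes and the maps induced on them\<close>

abbreviation cohomology_class :: "('k, 'v) cochain \<Rightarrow> int \<Rightarrow> 'v \<Rightarrow> 'v set" where
  "cohomology_class X m z \<equiv> coboundaries X m +>\<^bsub>cx X m\<^esub> z"

lemma cocycle_carrier: "z \<in> cocycles X m \<Longrightarrow> z \<in> carrier (cx X m)"
  by (simp add: cocycles_def)

lemma cocycles_subspace:
  assumes "is_complex K X"
  shows "\<zero>\<^bsub>cx X m\<^esub> \<in> cocycles X m"
    and "x \<in> cocycles X m \<Longrightarrow> y \<in> cocycles X m \<Longrightarrow> x \<oplus>\<^bsub>cx X m\<^esub> y \<in> cocycles X m"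
    and "a \<in> carrier K \<Longrightarrow> x \<in> cocycles X m \<Longrightarrow> a \<odot>\<^bsub>cx X m\<^esub> x \<in> cocycles X m"
proof -
  interpret M: module K "cx X m" by (rule complex_module[OF assms])
  interpret N: module K "cx X (m + 1)" by (rule complex_module[OF assms])
  note d = complex_diff[OF assms, of m]
  show "\<zero>\<^bsub>cx X m\<^esub> \<in> cocycles X m"
    using linear_map_zero[OF M.module_axioms N.module_axioms d] by (simp add: cocycles_def)
  show "x \<oplus>\<^bsub>cx X m\<^esub> y \<in> cocycles X m" if "x \<in> cocycles X m" "y \<in> cocycles X m"
    using that by (simp add: cocycles_def linear_map_add[OF d])
  show "a \<odot>\<^bsub>cx X m\<^esub> x \<in> cocycles X m" if "a \<in> carrier K" "x \<in> cocycles X m"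
    using that by (simp add: cocycles_def linear_map_smult[OF d])
qed

text \<open>Opens the coset theory of \<open>abelian_subgroup\<close> to cohomology classes.\<close>

lemma coboundaries_subgroup:
  assumes "is_complex K X"
  shows "abelian_subgroup (coboundaries X m) (cx X m)"
proof -
  interpret M: module K "cx X m" by (rule complex_module[OF assms])
  interpret N: module K "cx X (m - 1)" by (rule complex_module[OF assms])
  note d = complex_diff_prev[OF assms, of m]
  have "additive_subgroup (coboundaries X m) (cx X m)"
  proof (rule additive_subgroup.intro, rule M.add.subgroupI)
    show "coboundaries X m \<subseteq> carrier (cx X m)"
      using linear_map_closed[OF d] by (auto simp: coboundaries_def)
    show "coboundaries X m \<noteq> {}"
      by (auto simp: coboundaries_def)
  next
    fix a assume "a \<in> coboundaries X m"
    then obtain x where "x \<in> carrier (cx X (m - 1))" "a = diff X (m - 1) x"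
      by (auto simp: coboundaries_def)
    then show "\<ominus>\<^bsub>cx X m\<^esub> a \<in> coboundaries X m"
      using linear_map_minus[OF N.module_axioms M.module_axioms d]
      by (metis N.a_inv_closed coboundaries_def imageI)
  next
    fix a b assume "a \<in> coboundaries X m" "b \<in> coboundaries X m"
    then obtain x y where "x \<in> carrier (cx X (m - 1))" "a = diff X (m - 1) x"
      "y \<in> carrier (cx X (m - 1))" "b = diff X (m - 1) y"
      by (auto simp: coboundaries_def)
    then show "a \<oplus>\<^bsub>cx X m\<^esub> b \<in> coboundaries X m"
      using linear_map_add[OF d] by (metis N.a_closed coboundaries_def imageI)
  qed
  then show ?thesis
    by (rule abelian_subgroupI3) (rule M.abelian_group_axioms)
qed

lemma coboundaries_smult:
  assumes "is_complex K X" "a \<in> carrier K" "b \<in> coboundaries X m"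
  shows "a \<odot>\<^bsub>cx X m\<^esub> b \<in> coboundaries X m"
proof -
  interpret N: module K "cx X (m - 1)" by (rule complex_module[OF assms(1)])
  obtain x where "x \<in> carrier (cx X (m - 1))" "b = diff X (m - 1) x"
    using assms(3) by (auto simp: coboundaries_def)
  then show ?thesis
    using linear_map_smult[OF complex_diff_prev[OF assms(1), of m] assms(2)] assms(2)
    by (metis N.smult_closed coboundaries_def imageI)
qed

text \<open>Scalar multiplication on cohomology and \<open>cohomology_map\<close> both take the
  image of a coset and saturate it by adding the subgroup. The image is a nonempty part of a single
  coset, and any one of its points already generates that coset.\<close>

lemma (in abelian_subgroup) set_add_within_coset:
  assumes "z \<in> carrier G" "S \<subseteq> H +> z" "S \<noteq> {}"
  shows "H <+> S = H +> z"
proof -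
  obtain s where s: "s \<in> S" using assms(3) by blast
  have H: "H \<subseteq> carrier G" by (rule a_subset)
  have "h \<oplus> (h' \<oplus> z) = (h \<oplus> h') \<oplus> z" "h \<oplus> h' \<in> H" if "h \<in> H" "h' \<in> H" for h h'
    using that H assms(1) by (auto simp: a_assoc subset_iff)
  then have "H <+> S \<subseteq> H +> z"
    using assms(2) by (fastforce simp: set_add_def' a_r_coset_def')
  moreover have "H +> z = H +> s"
    using s assms by (intro a_repr_independence a_subgroup) auto
  then have "H +> z \<subseteq> H <+> S"
    using s by (auto simp: set_add_def' a_r_coset_def')
  ultimately show ?thesis by blast
qed

lemma cohomology_carrier:
  "carrier (cohomology X m) = cohomology_class X m ` cocycles X m"
  by (simp add: cohomology_def)

text \<open>Writing \<open>x\<close> as a coboundary plus \<open>y\<close>, instead of asking for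
  the difference to be a coboundary, matches the shape of a right coset and keeps subtraction out of
  the cone computations.\<close>

lemma cohomology_class_eq_iff:
  assumes "is_complex K X" "x \<in> carrier (cx X m)" "y \<in> carrier (cx X m)"
  shows "cohomology_class X m x = cohomology_class X m y \<longleftrightarrow>
    (\<exists>b \<in> coboundaries X m. x = b \<oplus>\<^bsub>cx X m\<^esub> y)"
proof -
  interpret abelian_subgroup "coboundaries X m" "cx X m"
    by (rule coboundaries_subgroup[OF assms(1)])
  have "cohomology_class X m x = cohomology_class X m y \<longleftrightarrow> x \<in> cohomology_class X m y"
    using a_repr_independence[OF _ assms(3) a_subgroup] a_rcos_self[OF assms(2)] by metis
  then show ?thesis
    by (auto simp: a_r_coset_def')
qed

lemma cohomology_zero:
  assumes "is_complex K X"
  shows "\<zero>\<^bsub>cohomology X m\<^esub> = cohomology_class X m \<zero>\<^bsub>cx X m\<^esub>"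
proof -
  interpret abelian_subgroup "coboundaries X m" "cx X m"
    by (rule coboundaries_subgroup[OF assms])
  show ?thesis
    using a_coset_add_zero[OF a_subset] by (simp add: cohomology_def)
qed

lemma cohomology_class_zero_iff:
  assumes "is_complex K X" "x \<in> carrier (cx X m)"
  shows "cohomology_class X m x = \<zero>\<^bsub>cohomology X m\<^esub> \<longleftrightarrow> x \<in> coboundaries X m"
proof -
  interpret abelian_subgroup "coboundaries X m" "cx X m"
    by (rule coboundaries_subgroup[OF assms(1)])
  have "b \<oplus>\<^bsub>cx X m\<^esub> \<zero>\<^bsub>cx X m\<^esub> = b" if "b \<in> coboundaries X m" for b
    using that a_subset by auto
  then show ?thesis
    using assms by (auto simp: cohomology_zero cohomology_class_eq_iff)
qed

lemma cohomology_add: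
  assumes "is_complex K X" "x \<in> carrier (cx X m)" "y \<in> carrier (cx X m)"
  shows "cohomology_class X m x \<oplus>\<^bsub>cohomology X m\<^esub> cohomology_class X m y =
    cohomology_class X m (x \<oplus>\<^bsub>cx X m\<^esub> y)"
proof -
  interpret abelian_subgroup "coboundaries X m" "cx X m"
    by (rule coboundaries_subgroup[OF assms(1)])
  show ?thesis
    using a_rcos_sum[OF assms(2,3)] by (simp add: cohomology_def)
qed

lemma cohomology_smult:
  assumes "is_complex K X" "a \<in> carrier K" "x \<in> carrier (cx X m)"
  shows "a \<odot>\<^bsub>cohomology X m\<^esub> cohomology_class X m x =
    cohomology_class X m (a \<odot>\<^bsub>cx X m\<^esub> x)"
proof -
  interpret abelian_subgroup "coboundaries X m" "cx X m"
    by (rule coboundaries_subgroup[OF assms(1)])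
  interpret M: module K "cx X m" by (rule complex_module[OF assms(1)])
  have "a \<odot>\<^bsub>cx X m\<^esub> (b \<oplus>\<^bsub>cx X m\<^esub> x) \<in> cohomology_class X m (a \<odot>\<^bsub>cx X m\<^esub> x)"
    if "b \<in> coboundaries X m" for b
    using that a_subset assms coboundaries_smult[OF assms(1,2) that]
    by (auto simp: M.smult_r_distr a_r_coset_def' subset_iff)
  then have "(\<lambda>v. a \<odot>\<^bsub>cx X m\<^esub> v) ` cohomology_class X m x
      \<subseteq> cohomology_class X m (a \<odot>\<^bsub>cx X m\<^esub> x)"
    by (auto simp: a_r_coset_def' image_iff)
  moreover have "cohomology_class X m x \<noteq> {}"
    using a_rcos_self[OF assms(3)] by blast
  ultimately show ?thesis
    using set_add_within_coset assms by (simp add: cohomology_def)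
qed

text \<open>The first two are the side conditions of \<open>linear_maps_cong\<close> and
  \<open>inv_linear_map\<close>; the last is used when exactness is transported.\<close>

lemma cohomology_closed:
  assumes "is_complex K X"
  shows "x \<in> carrier (cohomology X m) \<Longrightarrow> y \<in> carrier (cohomology X m) \<Longrightarrow>
      x \<oplus>\<^bsub>cohomology X m\<^esub> y \<in> carrier (cohomology X m)"
    and "a \<in> carrier K \<Longrightarrow> x \<in> carrier (cohomology X m) \<Longrightarrow>
      a \<odot>\<^bsub>cohomology X m\<^esub> x \<in> carrier (cohomology X m)"
    and "\<zero>\<^bsub>cohomology X m\<^esub> \<in> carrier (cohomology X m)"
  using assms cocycles_subspace[OF assms]
  by (auto simp: cohomology_carrier cohomology_add cohomology_smult cohomology_zero cocycle_carrier)

lemma cohomology_smult_null: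
  assumes "is_complex K X" "z \<in> carrier (cohomology X m)"
  shows "\<zero>\<^bsub>K\<^esub> \<odot>\<^bsub>cohomology X m\<^esub> z = \<zero>\<^bsub>cohomology X m\<^esub>"
proof -
  interpret module K "cx X m" by (rule complex_module[OF assms(1)])
  show ?thesis
    using assms by (auto simp: cohomology_carrier cohomology_smult cohomology_zero cocycle_carrier)
qed

text \<open>Again zero is 0 times zero; \<open>cohomology_smult_null\<close> supplies the scalar law
  on both sides.\<close>

lemma cohomology_linear_map_zero:
  assumes "is_complex K X" "is_complex K Y"
    and "f \<in> linear_maps K (cohomology X m) (cohomology Y n)"
  shows "f \<zero>\<^bsub>cohomology X m\<^esub> = \<zero>\<^bsub>cohomology Y n\<^esub>"
proof -
  interpret module K "cx X m" by (rule complex_module[OF assms(1)])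
  note z = cohomology_closed(3)[OF assms(1), of m]
  have "f (\<zero>\<^bsub>K\<^esub> \<odot>\<^bsub>cohomology X m\<^esub> \<zero>\<^bsub>cohomology X m\<^esub>) =
      \<zero>\<^bsub>K\<^esub> \<odot>\<^bsub>cohomology Y n\<^esub> f \<zero>\<^bsub>cohomology X m\<^esub>"
    by (rule linear_map_smult[OF assms(3) _ z]) simp
  then show ?thesis
    using cohomology_smult_null[OF assms(2) linear_map_closed[OF assms(3) z]]
      cohomology_smult_null[OF assms(1) z] by simp
qed

lemma chain_map_cocycles:
  assumes "is_complex K X" "is_complex K Y" "\<phi> \<in> chain_maps K X Y" "z \<in> cocycles X m"
  shows "\<phi> m z \<in> cocycles Y m"
  using assms(4) linear_map_closed[OF chain_map_linear[OF assms(3)]]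
    linear_map_zero[OF complex_module[OF assms(1)] complex_module[OF assms(2)]
      chain_map_linear[OF assms(3)]]
    chain_map_diff[OF assms(3), symmetric]
  by (simp add: cocycles_def)

lemma chain_map_coboundaries:
  assumes "is_complex K X" "\<phi> \<in> chain_maps K X Y" "b \<in> coboundaries X m"
  shows "\<phi> m b \<in> coboundaries Y m"
proof -
  obtain x where "x \<in> carrier (cx X (m - 1))" "b = diff X (m - 1) x"
    using assms(3) by (auto simp: coboundaries_def)
  then show ?thesis
    using chain_map_diff[OF assms(2), of x "m - 1"]
      linear_map_closed[OF chain_map_linear[OF assms(2), of "m - 1"]]
    by (simp add: coboundaries_def)
qed

text \<open>Well-definedness on classes: since \<open>\<phi>\<close> preserves coboundaries, it
  carries the coset of \<open>z\<close> into the coset of \<open>\<phi> m z\<close>, which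
  saturation then fills.\<close>

lemma cohomology_map_class:
  assumes "is_complex K X" "is_complex K Y" "\<phi> \<in> chain_maps K X Y" "z \<in> carrier (cx X m)"
  shows "cohomology_map Y m \<phi> (cohomology_class X m z) = cohomology_class Y m (\<phi> m z)"
proof -
  interpret X: abelian_subgroup "coboundaries X m" "cx X m"
    by (rule coboundaries_subgroup[OF assms(1)])
  interpret Y: abelian_subgroup "coboundaries Y m" "cx Y m"
    by (rule coboundaries_subgroup[OF assms(2)])
  note lin = chain_map_linear[OF assms(3), of m]
  have "\<phi> m (b \<oplus>\<^bsub>cx X m\<^esub> z) \<in> cohomology_class Y m (\<phi> m z)" if "b \<in> coboundaries X m" for b
    using that X.a_subset assms(4) chain_map_coboundaries[OF assms(1,3) that]
    by (auto simp: linear_map_add[OF lin] a_r_coset_def' subset_iff)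
  then have "\<phi> m ` cohomology_class X m z \<subseteq> cohomology_class Y m (\<phi> m z)"
    by (auto simp: a_r_coset_def' image_iff)
  moreover have "cohomology_class X m z \<noteq> {}"
    using X.a_rcos_self[OF assms(4)] by blast
  ultimately show ?thesis
    using Y.set_add_within_coset linear_map_closed[OF lin assms(4)]
    by (simp add: cohomology_map_def)
qed

lemma cohomology_map_linear:
  assumes "is_complex K X" "is_complex K Y" "\<phi> \<in> chain_maps K X Y"
  shows "cohomology_map Y m \<phi> \<in> linear_maps K (cohomology X m) (cohomology Y m)"
proof -
  note lin = chain_map_linear[OF assms(3), of m]
  interpret module K "cx X m" by (rule complex_module[OF assms(1)])
  note simps = cohomology_map_class[OF assms] cohomology_add[OF assms(1)]
    cohomology_add[OF assms(2)] cohomology_smult[OF assms(1)] cohomology_smult[OF assms(2)]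
    linear_map_closed[OF lin] linear_map_add[OF lin] linear_map_smult[OF lin] cocycle_carrier
  show ?thesis
    using chain_map_cocycles[OF assms]
    by (auto simp: linear_maps_def cohomology_carrier simps)
qed

lemma cohomology_map_id:
  assumes "is_complex K X" "z \<in> carrier (cohomology X m)"
  shows "cohomology_map X m (chain_id X) z = z"
  using assms(2) cohomology_map_class[OF assms(1,1) chain_id_chain_maps[OF assms(1)]]
  by (auto simp: cohomology_carrier cocycle_carrier chain_id_def)

lemma cohomology_map_comp:
  assumes "is_complex K X" "is_complex K Y" "is_complex K Z"
    and "\<phi> \<in> chain_maps K X Y" "\<psi> \<in> chain_maps K Y Z" "z \<in> carrier (cohomology X m)"
  shows "cohomology_map Z m (chain_comp X \<psi> \<phi>) z = cohomology_map Z m \<psi> (cohomology_map Y m \<phi> z)"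
  using assms(6) cohomology_map_class[OF assms(1,3) chain_comp_chain_maps[OF assms(1,4,5)]]
    cohomology_map_class[OF assms(1,2,4)] cohomology_map_class[OF assms(2,3,5)]
    linear_map_closed[OF chain_map_linear[OF assms(4)]]
  by (auto simp: cohomology_carrier cocycle_carrier chain_comp_def compose_def)

text \<open>Reduces exactness to cochains, so that no coset appears in the computations with cones.
  The premise \<open>comp\<close> puts the image into the kernel, \<open>ker\<close> gives the
  converse.\<close>

lemma cohomology_exact_atI:
  assumes "is_complex K X" "is_complex K Y" "is_complex K Z"
    and "\<phi> \<in> chain_maps K X Y" "\<psi> \<in> chain_maps K Y Z"
    and comp: "\<And>x. x \<in> cocycles X m \<Longrightarrow> \<psi> m (\<phi> m x) \<in> coboundaries Z m"
    and ker: "\<And>y. y \<in> cocycles Y m \<Longrightarrow> \<psi> m y \<in> coboundaries Z m \<Longrightarrow>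
      \<exists>x \<in> cocycles X m. \<exists>b \<in> coboundaries Y m. y = b \<oplus>\<^bsub>cx Y m\<^esub> \<phi> m x"
  shows "exact_at K (cohomology X m) (cohomology_map Y m \<phi>) (cohomology Y m)
    (cohomology_map Z m \<psi>) (cohomology Z m)"
proof -
  note cl = cohomology_map_class[OF assms(1,2,4)] cohomology_map_class[OF assms(2,3,5)]
  note co = chain_map_cocycles[OF assms(1,2,4)] chain_map_cocycles[OF assms(2,3,5)]
  note car = co[THEN cocycle_carrier] cocycle_carrier
  have "cohomology_map Y m \<phi> ` carrier (cohomology X m) =
      {y \<in> carrier (cohomology Y m). cohomology_map Z m \<psi> y = \<zero>\<^bsub>cohomology Z m\<^esub>}" (is "?I = ?K")
  proof
    have "cohomology_class Z m (\<psi> m (\<phi> m x)) = \<zero>\<^bsub>cohomology Z m\<^esub>" if "x \<in> cocycles X m" for x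
      using comp[OF that] car(2)[OF co(1)[OF that]]
      by (simp only: cohomology_class_zero_iff[OF assms(3)])
    then show "?I \<subseteq> ?K"
      using co by (auto simp: cohomology_carrier cl car)
    show "?K \<subseteq> ?I"
    proof
      fix c assume "c \<in> ?K"
      then obtain y where y: "y \<in> cocycles Y m" "c = cohomology_class Y m y"
        "\<psi> m y \<in> coboundaries Z m"
        by (auto simp: cohomology_carrier cl car cohomology_class_zero_iff[OF assms(3)])
      obtain x b where x: "x \<in> cocycles X m" "b \<in> coboundaries Y m" "y = b \<oplus>\<^bsub>cx Y m\<^esub> \<phi> m x"
        using ker[OF y(1,3)] by blast
      have "c = cohomology_class Y m (\<phi> m x)"
        unfolding y(2) using x y by (subst cohomology_class_eq_iff[OF assms(2)]) (auto simp: car)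
      then show "c \<in> ?I"
        using x(1) cl(1)[OF cocycle_carrier[OF x(1)], symmetric] by (auto simp: cohomology_carrier)
    qed
  qed
  then show ?thesis
    using cohomology_map_linear[OF assms(1,2,4)] cohomology_map_linear[OF assms(2,3,5)]
    by (simp add: exact_at_def)
qed

section \<open>Shifted complexes and zigzags\<close>

lemma cx_cshift [simp]: "cx (cshift X) n = cx X (n + 1)"
  by (simp add: cshift_def)

lemma diff_cshift: "diff (cshift X) n x = \<ominus>\<^bsub>cx X (n + 2)\<^esub> diff X (n + 1) x"
  by (simp add: cshift_def)

lemma is_complex_cshift:
  assumes "is_complex K X"
  shows "is_complex K (cshift X)"
proof -
  have "diff (cshift X) n \<in> linear_maps K (cx X (n + 1)) (cx X (n + 2))" for n
  proof -
    interpret M: module K "cx X (n + 1)" by (rule complex_module[OF assms])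
    interpret N: module K "cx X (n + 2)" by (rule complex_module[OF assms])
    \<comment> \<open>\<open>complex_diff\<close> ends in degree \<open>n + 1 + 1\<close>;
      \<open>add.assoc\<close> brings this to the form \<open>n + 2\<close> used in
      \<open>cshift\<close>. The same adjustment recurs below.\<close>
    have d: "diff X (n + 1) \<in> linear_maps K (cx X (n + 1)) (cx X (n + 2))"
      using complex_diff[OF assms, of "n + 1"] by (simp add: add.assoc)
    show ?thesis
      using linear_map_closed[OF d] linear_map_add[OF d] linear_map_smult[OF d]
      by (auto simp: linear_maps_def diff_cshift N.minus_add N.smult_r_minus)
  qed
  moreover have "diff (cshift X) (n + 1) (diff (cshift X) n x) = \<zero>\<^bsub>cx X (n + 3)\<^esub>"
    if x: "x \<in> carrier (cx X (n + 1))" for n x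
  proof -
    interpret N: module K "cx X (n + 2)" by (rule complex_module[OF assms])
    interpret P: module K "cx X (n + 3)" by (rule complex_module[OF assms])
    have d: "diff X (n + 1) \<in> linear_maps K (cx X (n + 1)) (cx X (n + 2))"
      "diff X (n + 2) \<in> linear_maps K (cx X (n + 2)) (cx X (n + 3))"
      using complex_diff[OF assms, of "n + 1"] complex_diff[OF assms, of "n + 2"]
      by (simp_all add: add.assoc)
    show ?thesis
      using complex_diff_diff[OF assms x] linear_map_closed[OF d(1) x]
        linear_map_minus[OF N.module_axioms P.module_axioms d(2)]
      by (simp add: diff_cshift add.assoc)
  qed
  ultimately show ?thesis
    using complex_module[OF assms] by (simp add: is_complex_def add.assoc)
qed

text \<open>The sign of the shifted differential moves into its argument, and negation maps the
  space \<open>cx X m\<close> onto itself.\<close>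

lemma coboundaries_cshift:
  assumes "is_complex K X"
  shows "coboundaries (cshift X) m = coboundaries X (m + 1)"
proof -
  interpret M: module K "cx X m" by (rule complex_module[OF assms])
  interpret N: module K "cx X (m + 1)" by (rule complex_module[OF assms])
  note d = complex_diff[OF assms, of m]
  have "\<ominus>\<^bsub>cx X (m + 1)\<^esub> diff X m x = diff X m (\<ominus>\<^bsub>cx X m\<^esub> x)" if "x \<in> carrier (cx X m)" for x
    using linear_map_minus[OF M.module_axioms N.module_axioms d that] by simp
  then have "(\<lambda>x. \<ominus>\<^bsub>cx X (m + 1)\<^esub> diff X m x) ` carrier (cx X m) =
      diff X m ` (\<lambda>x. \<ominus>\<^bsub>cx X m\<^esub> x) ` carrier (cx X m)"
    by (simp add: image_image cong: image_cong)
  moreover have "(\<lambda>x. \<ominus>\<^bsub>cx X m\<^esub> x) ` carrier (cx X m) = carrier (cx X m)"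
    by (force simp: image_iff intro: M.minus_minus[symmetric])
  moreover have "diff (cshift X) (m - 1) = (\<lambda>x. \<ominus>\<^bsub>cx X (m + 1)\<^esub> diff X m x)"
    by (simp add: diff_cshift fun_eq_iff add.commute)
  ultimately show ?thesis
    by (simp add: coboundaries_def)
qed

lemma coboundary_cshift_iff:
  "is_complex K X \<Longrightarrow>
    x \<in> coboundaries (cshift X) m \<longleftrightarrow> (\<exists>y \<in> carrier (cx X m). x = diff X m y)"
  by (simp add: coboundaries_cshift) (auto simp: coboundaries_def)

lemma cocycles_cshift:
  assumes "is_complex K X"
  shows "cocycles (cshift X) m = cocycles X (m + 1)"
proof -
  interpret N: module K "cx X (m + 2)" by (rule complex_module[OF assms])
  have "diff X (m + 1) x \<in> carrier (cx X (m + 2))" if "x \<in> carrier (cx X (m + 1))" for x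
    using linear_map_closed[OF complex_diff[OF assms] that] by (simp add: add.assoc)
  then show ?thesis
    by (auto simp: cocycles_def diff_cshift add.assoc)
qed

text \<open>An equality of records, not just an isomorphism: a map into the cohomology of
  \<open>A[1]\<close> in degree \<open>m\<close> already is a map into that of \<open>A\<close> in
  degree \<open>m + 1\<close>.\<close>

lemma cohomology_cshift:
  "is_complex K X \<Longrightarrow> cohomology (cshift X) m = cohomology X (m + 1)"
  by (simp add: cohomology_def coboundaries_cshift cocycles_cshift)

lemma cohomology_map_cshift:
  "is_complex K Y \<Longrightarrow>
    cohomology_map (cshift Y) m (chain_shift \<phi>) = cohomology_map Y (m + 1) \<phi>"
  by (simp add: cohomology_map_def coboundaries_cshift chain_shift_def fun_eq_iff)

text \<open>Both differentials change sign and \<open>\<phi>\<close> commutes with negation, so the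
  shifted chain map carries no sign.\<close>

lemma chain_shift_chain_maps:
  assumes "is_complex K X" "is_complex K Y" "\<phi> \<in> chain_maps K X Y"
  shows "chain_shift \<phi> \<in> chain_maps K (cshift X) (cshift Y)"
proof -
  have "\<phi> (n + 2) (\<ominus>\<^bsub>cx X (n + 2)\<^esub> diff X (n + 1) x) =
      \<ominus>\<^bsub>cx Y (n + 2)\<^esub> diff Y (n + 1) (\<phi> (n + 1) x)" if x: "x \<in> carrier (cx X (n + 1))" for n x
    using linear_map_minus[OF complex_module[OF assms(1)] complex_module[OF assms(2)]
        chain_map_linear[OF assms(3)], of _ "n + 2"]
      linear_map_closed[OF complex_diff[OF assms(1)] x] chain_map_diff[OF assms(3) x]
    by (simp add: add.assoc)
  then show ?thesis
    using assms(3) by (simp add: chain_maps_def chain_shift_def diff_cshift add.assoc)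
qed

lemma quasi_iso_chain_map: "s \<in> quasi_isos K X Y \<Longrightarrow> s \<in> chain_maps K X Y"
  by (simp add: quasi_isos_def)

lemma chain_shift_quasi_isos:
  assumes "is_complex K X" "is_complex K Y" "s \<in> quasi_isos K X Y"
  shows "chain_shift s \<in> quasi_isos K (cshift X) (cshift Y)"
  using assms chain_shift_chain_maps[OF assms(1,2)]
  by (auto simp: quasi_isos_def cohomology_cshift cohomology_map_cshift)

lemma chain_shift_id: "chain_shift (chain_id X) = chain_id (cshift X)"
  by (simp add: chain_shift_def chain_id_def fun_eq_iff)

lemma chain_shift_comp:
  "chain_shift (chain_comp X \<psi> \<phi>) = chain_comp (cshift X) (chain_shift \<psi>) (chain_shift \<phi>)"
  by (simp add: chain_shift_def chain_comp_def fun_eq_iff)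

section \<open>Zigzags and the congruence between them\<close>

lemma zigzag_complexes:
  "zigzag K X Y w \<Longrightarrow> is_complex K X \<and> is_complex K Y"
  by (induction rule: zigzag.induct) auto

lemma zigzag_append:
  "zigzag K X Y u \<Longrightarrow> zigzag K Y Z v \<Longrightarrow> zigzag K X Z (u @ v)"
  by (induction rule: zigzag.induct) (auto intro: zigzag.intros)

lemma zigzag_Fwd:
  "is_complex K X \<Longrightarrow> is_complex K Y \<Longrightarrow> \<phi> \<in> chain_maps K X Y \<Longrightarrow> zigzag K X Y [Fwd X Y \<phi>]"
  by (intro zigzag.intros)

lemma zigzag_shift:
  "zigzag K X Y w \<Longrightarrow> zigzag K (cshift X) (cshift Y) (map letter_shift w)"
proof (induction rule: zigzag.induct)
  case (3 Y s X Z w)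
  then show ?case
    using zigzag_complexes[OF 3(3)]
    by (auto intro!: zigzag.intros is_complex_cshift chain_shift_quasi_isos)
next
  case (2 X \<phi> Y Z w)
  then show ?case
    using zigzag_complexes[OF 2(3)]
    by (auto intro!: zigzag.intros is_complex_cshift chain_shift_chain_maps)
qed (auto intro!: zigzag.intros is_complex_cshift)

text \<open>Lets the congruence proofs recover well-formedness of both words from an equivalence
  alone.\<close>

lemma zigzag_eq_zigzag:
  "zigzag_eq K X Y w w' \<Longrightarrow> zigzag K X Y w \<and> zigzag K X Y w'"
proof (induction rule: zigzag_eq.induct)
  case (ident A u v)
  have "zigzag K A A [Fwd A A (chain_id A)]"
    using zigzag_complexes[OF ident(1)] chain_id_chain_maps by (blast intro: zigzag_Fwd)
  then show ?case
    using ident by (blast intro: zigzag_append)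
next
  case (comp A u \<phi> B \<psi> C v)
  \<comment> \<open>The rule \<open>comp\<close> only says that the middle object is a complex;
    \<open>A\<close> and \<open>C\<close> are complexes as endpoints of \<open>u\<close> and
    \<open>v\<close>.\<close>
  have *: "is_complex K A" "is_complex K C"
    using zigzag_complexes comp by blast+
  have "zigzag K A C [Fwd A C (chain_comp A \<psi> \<phi>)]"
    using * comp chain_comp_chain_maps by (blast intro: zigzag_Fwd)
  moreover have "zigzag K A C [Fwd A B \<phi>, Fwd B C \<psi>]"
    using * comp by (blast intro: zigzag.intros)
  ultimately show ?case
    using comp by (blast intro: zigzag_append)
next
  case (inv1 A u s B v)
  have "zigzag K A A [Fwd A B s, Bwd A B s]"
    using inv1 zigzag_complexes[OF inv1(1)] quasi_iso_chain_map by (blast intro: zigzag.intros)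
  then show ?case
    using inv1 by (blast intro: zigzag_append)
next
  case (inv2 B u s A v)
  have "zigzag K B B [Bwd A B s, Fwd A B s]"
    using inv2 zigzag_complexes[OF inv2(1)] quasi_iso_chain_map by (blast intro: zigzag.intros)
  then show ?case
    using inv2 by (blast intro: zigzag_append)
qed auto

text \<open>Each generating relation carries an arbitrary prefix and suffix, so appending on the
  left just lengthens the prefix. On the right, in the next lemma, it lengthens the suffix.\<close>

lemma zigzag_eq_append_left:
  assumes "zigzag_eq K X Y w w'" "zigzag K W X u"
  shows "zigzag_eq K W Y (u @ w) (u @ w')"
  using assms
proof (induction rule: zigzag_eq.induct)
  case (refl w)
  then show ?case by (blast intro: zigzag_eq.refl zigzag_append)
next
  case (sym w w')
  then show ?case by (blast intro: zigzag_eq.sym)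
next
  case (trans w w' w'')
  then show ?case by (blast intro: zigzag_eq.trans)
next
  case (ident A u' v)
  then show ?case
    using zigzag_eq.ident[of K W A "u @ u'" Y v] by (simp add: zigzag_append)
next
  case (comp A u' \<phi> B \<psi> C v)
  then show ?case
    using zigzag_eq.comp[of K W A "u @ u'" \<phi> B \<psi> C Y v] by (simp add: zigzag_append)
next
  case (inv1 A u' s B v)
  then show ?case
    using zigzag_eq.inv1[of K W A "u @ u'" s B Y v] by (simp add: zigzag_append)
next
  case (inv2 B u' s A v)
  then show ?case
    using zigzag_eq.inv2[of K W B "u @ u'" s A Y v] by (simp add: zigzag_append)
qed

lemma zigzag_eq_append_right:
  assumes "zigzag_eq K X Y w w'" "zigzag K Y Z v"
  shows "zigzag_eq K X Z (w @ v) (w' @ v)"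
  using assms
proof (induction rule: zigzag_eq.induct)
  case (refl w)
  then show ?case by (blast intro: zigzag_eq.refl zigzag_append)
next
  case (sym w w')
  then show ?case by (blast intro: zigzag_eq.sym)
next
  case (trans w w' w'')
  then show ?case by (blast intro: zigzag_eq.trans)
next
  case (ident A u v')
  then show ?case
    using zigzag_eq.ident[of K X A u Z "v' @ v"] zigzag_append by fastforce
next
  case (comp A u \<phi> B \<psi> C v')
  then show ?case
    using zigzag_eq.comp[of K X A u \<phi> B \<psi> C Z "v' @ v"] zigzag_append by fastforce
next
  case (inv1 A u s B v')
  then show ?case
    using zigzag_eq.inv1[of K X A u s B Z "v' @ v"] zigzag_append by fastforce
next
  case (inv2 B u s A v')
  then show ?case
    using zigzag_eq.inv2[of K X B u s A Z "v' @ v"] zigzag_append by fastforce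
qed

lemma zigzag_eq_append:
  assumes "zigzag_eq K X Y u u'" "zigzag_eq K Y Z v v'"
  shows "zigzag_eq K X Z (u @ v) (u' @ v')"
  using zigzag_eq_append_right[OF assms(1)] zigzag_eq_append_left[OF assms(2)]
    zigzag_eq_zigzag[OF assms(1)] zigzag_eq_zigzag[OF assms(2)]
  by (blast intro: zigzag_eq.trans)

text \<open>Shifting preserves identities, composites and quasi-isomorphisms of complexes, hence
  sends each generating relation to one of the same kind.\<close>

lemma zigzag_eq_shift:
  assumes "zigzag_eq K X Y w w'"
  shows "zigzag_eq K (cshift X) (cshift Y) (map letter_shift w) (map letter_shift w')"
  using assms
proof (induction rule: zigzag_eq.induct)
  case (refl w)
  then show ?case by (blast intro: zigzag_eq.refl zigzag_shift)
next
  case (sym w w')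
  then show ?case by (blast intro: zigzag_eq.sym)
next
  case (trans w w' w'')
  then show ?case by (blast intro: zigzag_eq.trans)
next
  case (ident A u v)
  then show ?case
    using zigzag_eq.ident[OF ident[THEN zigzag_shift]] by (simp add: chain_shift_id)
next
  case (comp A u \<phi> B \<psi> C v)
  then have "is_complex K A" "is_complex K C"
    using zigzag_complexes by blast+
  then show ?case
    using zigzag_eq.comp[OF comp(1)[THEN zigzag_shift]
        chain_shift_chain_maps[OF _ comp(3,2)] is_complex_cshift[OF comp(3)]
        chain_shift_chain_maps[OF comp(3) _ comp(4)] comp(5)[THEN zigzag_shift]]
    by (simp add: chain_shift_comp)
next
  case (inv1 A u s B v)
  then show ?case
    using zigzag_eq.inv1[OF inv1(1)[THEN zigzag_shift] _ is_complex_cshift[OF inv1(3)]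
        inv1(4)[THEN zigzag_shift]] chain_shift_quasi_isos zigzag_complexes
    by simp blast
next
  case (inv2 B u s A v)
  then show ?case
    using zigzag_eq.inv2[OF inv2(1)[THEN zigzag_shift] _ is_complex_cshift[OF inv2(3)]
        inv2(4)[THEN zigzag_shift]] chain_shift_quasi_isos zigzag_complexes
    by simp blast
qed

section \<open>The derived category\<close>

text \<open>\<open>DVect K\<close> is a record without addition on Hom sets, so
  \<open>lin_additive_category\<close> cannot be instantiated by it. This common part makes
  composition of isomorphisms available both there and in the linear categories; shift comparisons
  of composite functors need both.\<close>

locale category_laws =
  fixes C :: "('o, 'm, 'x) category_scheme" (structure)
  assumes cmp_hom: "\<lbrakk>f \<in> Hom C X Y; g \<in> Hom C Y Z\<rbrakk> \<Longrightarrow> g \<cdot> f \<in> Hom C X Z"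
    and cmp_ide: "f \<in> Hom C X Y \<Longrightarrow> f \<cdot> ide C X = f \<and> ide C Y \<cdot> f = f"
    and cmp_assoc: "\<lbrakk>f \<in> Hom C W X; g \<in> Hom C X Y; h \<in> Hom C Y Z\<rbrakk> \<Longrightarrow> h \<cdot> (g \<cdot> f) = (h \<cdot> g) \<cdot> f"
begin

lemma isos_comp:
  assumes "f \<in> isos C X Y" "g \<in> isos C Y Z"
  shows "g \<cdot> f \<in> isos C X Z"
proof -
  obtain f' where f: "f \<in> Hom C X Y" "f' \<in> Hom C Y X" "f' \<cdot> f = ide C X" "f \<cdot> f' = ide C Y"
    using assms(1) by (auto simp: isos_def)
  obtain g' where g: "g \<in> Hom C Y Z" "g' \<in> Hom C Z Y" "g' \<cdot> g = ide C Y" "g \<cdot> g' = ide C Z"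
    using assms(2) by (auto simp: isos_def)
  have "(f' \<cdot> g') \<cdot> (g \<cdot> f) = f' \<cdot> ((g' \<cdot> g) \<cdot> f)"
    by (simp only: cmp_assoc[OF cmp_hom[OF f(1) g(1)] g(2) f(2), symmetric]
        cmp_assoc[OF f(1) g(1,2)])
  moreover have "(g \<cdot> f) \<cdot> (f' \<cdot> g') = g \<cdot> ((f \<cdot> f') \<cdot> g')"
    by (simp only: cmp_assoc[OF cmp_hom[OF g(2) f(2)] f(1) g(1), symmetric]
        cmp_assoc[OF g(2) f(2,1)])
  ultimately show ?thesis
    using f g cmp_ide[OF f(1)] cmp_ide[OF g(2)] cmp_hom[OF f(1) g(1)] cmp_hom[OF g(2) f(2)]
    by (auto simp: isos_def intro!: bexI[of _ "f' \<cdot> g'"])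
qed

end

sublocale lin_additive_category \<subseteq> category_laws C
  by unfold_locales (fact cmp_hom cmp_ide cmp_assoc)+

text \<open>\<open>dcomp\<close> collects the words reached from all pairs of representatives; by
  the congruence they form a single class. Associativity and unit laws of the derived category
  thereby become those of list append.\<close>

lemma dcomp_dclass:
  assumes "zigzag K X Y u" "zigzag K Y Z v"
  shows "dcomp K (dclass K Y Z v) (dclass K X Y u) = dclass K X Z (u @ v)"
proof -
  have "(\<exists>u'. zigzag_eq K X Y u u' \<and> (\<exists>v'. zigzag_eq K Y Z v v' \<and> zigzag_eq K X Z (u' @ v') w))
      \<longleftrightarrow> zigzag_eq K X Z (u @ v) w" for w
    using assms by (blast intro: zigzag_eq.refl zigzag_eq.trans zigzag_eq_append)
  then show ?thesis
    by (simp add: dcomp_def dclass_def Bex_def)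
qed

lemma dshift_dclass:
  assumes "zigzag K X Y w"
  shows "dshift K (dclass K X Y w) = dclass K (cshift X) (cshift Y) (map letter_shift w)"
proof -
  have "(\<exists>u. zigzag_eq K X Y w u \<and> zigzag_eq K (cshift X) (cshift Y) (map letter_shift u) v)
      \<longleftrightarrow> zigzag_eq K (cshift X) (cshift Y) (map letter_shift w) v" for v
    using assms by (blast intro: zigzag_eq.refl zigzag_eq.trans zigzag_eq_shift)
  then show ?thesis
    by (simp add: dshift_def dclass_def Bex_def)
qed

lemma DVect_simps [simp]:
  "obs (DVect K) = {X. is_complex K X}"
  "ide (DVect K) X = dclass K X X []"
  "cmp (DVect K) = dcomp K"
  "shO (DVect K) = cshift"
  "shM (DVect K) = dshift K"
  by (simp_all add: DVect_def DVect_pre_def)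

lemma DVect_pre_simps [simp]:
  "obs (DVect_pre K) = {X. is_complex K X}"
  "ide (DVect_pre K) X = dclass K X X []"
  "cmp (DVect_pre K) = dcomp K"
  "shO (DVect_pre K) = cshift"
  "shM (DVect_pre K) = dshift K"
  "src (DVect_pre K) = fst"
  by (simp_all add: DVect_pre_def)

text \<open>Distinguished triangles are defined by isomorphisms in \<open>DVect_pre\<close>. The two
  records differ only in \<open>dist\<close>, so these isomorphisms may be read in
  \<open>DVect\<close>.\<close>

lemma Hom_DVect_pre: "Hom (DVect_pre K) X Y = Hom (DVect K) X Y"
  by (simp add: Hom_def DVect_def DVect_pre_def)

lemma isos_DVect_pre: "isos (DVect_pre K) X Y = isos (DVect K) X Y"
  by (simp add: isos_def Hom_DVect_pre)

lemma Hom_DVect: "Hom (DVect K) X Y = {dclass K X Y w | w. zigzag K X Y w}"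
  by (auto simp: Hom_def DVect_def DVect_pre_def dclass_def)

lemma Hom_DVectE:
  assumes "\<alpha> \<in> Hom (DVect K) X Y"
  obtains w where "\<alpha> = dclass K X Y w" "zigzag K X Y w"
  using assms by (auto simp: Hom_DVect)

lemma Hom_DVect_complexes:
  "\<alpha> \<in> Hom (DVect K) X Y \<Longrightarrow> is_complex K X \<and> is_complex K Y"
  by (auto simp: Hom_DVect dest: zigzag_complexes)

lemma fst_Hom_DVect: "\<alpha> \<in> Hom (DVect K) X Y \<Longrightarrow> fst \<alpha> = X"
  by (auto simp: Hom_DVect dclass_def)

lemma dcomp_Hom:
  "\<alpha> \<in> Hom (DVect K) X Y \<Longrightarrow> \<beta> \<in> Hom (DVect K) Y Z \<Longrightarrow> dcomp K \<beta> \<alpha> \<in> Hom (DVect K) X Z"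
  by (auto simp: Hom_DVect dcomp_dclass intro: zigzag_append)

lemma dcomp_assoc:
  assumes "\<alpha> \<in> Hom (DVect K) W X" "\<beta> \<in> Hom (DVect K) X Y" "\<gamma> \<in> Hom (DVect K) Y Z"
  shows "dcomp K (dcomp K \<gamma> \<beta>) \<alpha> = dcomp K \<gamma> (dcomp K \<beta> \<alpha>)"
  using assms by (auto simp: Hom_DVect dcomp_dclass zigzag_append)

lemma dcomp_ide:
  assumes "\<alpha> \<in> Hom (DVect K) X Y"
  shows "dcomp K \<alpha> (dclass K X X []) = \<alpha>" "dcomp K (dclass K Y Y []) \<alpha> = \<alpha>"
proof -
  obtain w where w: "\<alpha> = dclass K X Y w" "zigzag K X Y w"
    using assms by (rule Hom_DVectE)
  have "zigzag K X X []" "zigzag K Y Y []"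
    using zigzag_complexes[OF w(2)] by (auto intro: zigzag.intros)
  then show "dcomp K \<alpha> (dclass K X X []) = \<alpha>" "dcomp K (dclass K Y Y []) \<alpha> = \<alpha>"
    using w by (simp_all add: dcomp_dclass)
qed

lemma dshift_Hom:
  "\<alpha> \<in> Hom (DVect K) X Y \<Longrightarrow> dshift K \<alpha> \<in> Hom (DVect K) (cshift X) (cshift Y)"
  by (auto simp: Hom_DVect dshift_dclass intro: zigzag_shift)

lemma dshift_comp:
  assumes "\<alpha> \<in> Hom (DVect K) X Y" "\<beta> \<in> Hom (DVect K) Y Z"
  shows "dshift K (dcomp K \<beta> \<alpha>) = dcomp K (dshift K \<beta>) (dshift K \<alpha>)"
  using assms by (auto simp: Hom_DVect dshift_dclass dcomp_dclass zigzag_append zigzag_shift)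

lemma dshift_ide: "is_complex K X \<Longrightarrow> dshift K (dclass K X X []) = dclass K (cshift X) (cshift X) []"
  by (simp add: dshift_dclass zigzag.intros)

interpretation DVect: category_laws "DVect K" for K
  by unfold_locales (auto simp: dcomp_Hom dcomp_assoc dcomp_ide)

lemma DVect_isos_shift:
  assumes "\<alpha> \<in> isos (DVect K) X Y"
  shows "dshift K \<alpha> \<in> isos (DVect K) (cshift X) (cshift Y)"
proof -
  obtain \<alpha>' where \<alpha>: "\<alpha> \<in> Hom (DVect K) X Y" "\<alpha>' \<in> Hom (DVect K) Y X"
    "dcomp K \<alpha>' \<alpha> = dclass K X X []" "dcomp K \<alpha> \<alpha>' = dclass K Y Y []"
    using assms by (auto simp: isos_def)
  have "dcomp K (dshift K \<alpha>') (dshift K \<alpha>) = dclass K (cshift X) (cshift X) []"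
    "dcomp K (dshift K \<alpha>) (dshift K \<alpha>') = dclass K (cshift Y) (cshift Y) []"
    using \<alpha> Hom_DVect_complexes[OF \<alpha>(1)] by (simp_all flip: dshift_comp add: dshift_ide)
  then show ?thesis
    using \<alpha>(1,2) by (auto simp: isos_def intro: dshift_Hom)
qed

section \<open>Cohomology as a functor on the derived category\<close>

lemma zigzag_cohomology_shift:
  assumes "zigzag K X Y w"
  shows "zigzag_cohomology m (map letter_shift w) = zigzag_cohomology (m + 1) w"
  using assms
  by (induction rule: zigzag.induct)
    (auto simp: zigzag_cohomology_def cohomology_cshift cohomology_map_cshift dest: zigzag_complexes)

text \<open>Besides linearity this keeps the intermediate values in the cohomology spaces, the only
  place where \<open>inv_into\<close> is a genuine inverse.\<close>

lemma zigzag_cohomology_linear: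
  assumes "zigzag K X Y w"
  shows "zigzag_cohomology m w \<in> linear_maps K (cohomology X m) (cohomology Y m)"
  using assms
proof (induction rule: zigzag.induct)
  case (1 X)
  then show ?case
    by (auto simp: zigzag_cohomology_def linear_maps_def)
next
  case (2 X \<phi> Y Z w)
  have "zigzag_cohomology m (Fwd X Y \<phi> # w) =
      (\<lambda>z. zigzag_cohomology m w (cohomology_map Y m \<phi> z))"
    by (simp add: zigzag_cohomology_def fun_eq_iff)
  then show ?case
    using linear_maps_comp[OF cohomology_map_linear[OF 2(1) _ 2(2)] 2(4)] zigzag_complexes[OF 2(3)]
    by simp
next
  case (3 Y s X Z w)
  have X: "is_complex K X" using zigzag_complexes[OF 3(3)] by simp
  have "inv_into (carrier (cohomology X m)) (cohomology_map Y m s)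
      \<in> linear_maps K (cohomology Y m) (cohomology X m)"
    using 3 X by (intro inv_linear_map cohomology_map_linear cohomology_closed)
      (auto simp: quasi_isos_def)
  moreover have "zigzag_cohomology m (Bwd X Y s # w) = (\<lambda>z. zigzag_cohomology m w
      (inv_into (carrier (cohomology X m)) (cohomology_map Y m s) z))"
    by (simp add: zigzag_cohomology_def fun_eq_iff)
  ultimately show ?case
    using 3(4) by (simp add: linear_maps_comp)
qed

lemma zigzag_cohomology_append:
  "zigzag_cohomology m (u @ v) z = zigzag_cohomology m v (zigzag_cohomology m u z)"
  by (simp add: zigzag_cohomology_def)

text \<open>Only equality on the carrier is claimed, because of \<open>inv_into\<close>. Each
  relation is tested on the class reached after the prefix \<open>u\<close>: \<open>inv1\<close>
  needs injectivity of the map induced by \<open>s\<close>, \<open>inv2\<close> its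
  surjectivity.\<close>

lemma zigzag_cohomology_cong:
  assumes "zigzag_eq K X Y w w'" "z \<in> carrier (cohomology X m)"
  shows "zigzag_cohomology m w z = zigzag_cohomology m w' z"
  using assms
proof (induction rule: zigzag_eq.induct)
  case (ident A u v)
  then have "zigzag_cohomology m u z \<in> carrier (cohomology A m)" "is_complex K A"
    by (auto intro: linear_map_closed zigzag_cohomology_linear dest: zigzag_complexes)
  then show ?case
    unfolding zigzag_cohomology_append by (simp add: zigzag_cohomology_def cohomology_map_id)
next
  case (comp A u \<phi> B \<psi> C v)
  then have "zigzag_cohomology m u z \<in> carrier (cohomology A m)" "is_complex K A" "is_complex K C"
    by (auto intro: linear_map_closed zigzag_cohomology_linear dest: zigzag_complexes)
  then show ?case
    unfolding zigzag_cohomology_append using comp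
    by (simp add: zigzag_cohomology_def cohomology_map_comp)
next
  case (inv1 A u s B v)
  then have "zigzag_cohomology m u z \<in> carrier (cohomology A m)"
    by (auto intro: linear_map_closed zigzag_cohomology_linear)
  moreover have "inj_on (cohomology_map B m s) (carrier (cohomology A m))"
    using inv1(2) by (auto simp: quasi_isos_def bij_betw_def)
  ultimately show ?case
    unfolding zigzag_cohomology_append by (simp add: zigzag_cohomology_def)
next
  case (inv2 B u s A v)
  then have "zigzag_cohomology m u z \<in> carrier (cohomology B m)"
    by (auto intro: linear_map_closed zigzag_cohomology_linear)
  moreover have "cohomology_map B m s ` carrier (cohomology A m) = carrier (cohomology B m)"
    using inv2(2) by (auto simp: quasi_isos_def bij_betw_def)
  ultimately show ?case
    unfolding zigzag_cohomology_append by (simp add: zigzag_cohomology_def f_inv_into_f)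
qed auto

text \<open>The class contains \<open>w\<close>, so \<open>SOME\<close> returns a word equivalent to
  \<open>w\<close>.\<close>

lemma dcohomology_dclass:
  assumes "zigzag K X Y w" "z \<in> carrier (cohomology X m)"
  shows "dcohomology m (dclass K X Y w) z = zigzag_cohomology m w z"
proof -
  have "w \<in> snd (snd (dclass K X Y w))"
    using assms by (simp add: dclass_def zigzag_eq.refl)
  then have "(SOME w'. w' \<in> snd (snd (dclass K X Y w))) \<in> snd (snd (dclass K X Y w))"
    by (rule someI)
  then have "zigzag_eq K X Y w (SOME w'. w' \<in> snd (snd (dclass K X Y w)))"
    by (simp add: dclass_def)
  from zigzag_cohomology_cong[OF this assms(2)] show ?thesis
    by (simp add: dcohomology_def)
qed

lemma dcohomology_linear:
  assumes "\<alpha> \<in> Hom (DVect K) X Y"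
  shows "dcohomology m \<alpha> \<in> linear_maps K (cohomology X m) (cohomology Y m)"
proof -
  obtain w where w: "\<alpha> = dclass K X Y w" "zigzag K X Y w"
    using assms by (rule Hom_DVectE)
  show ?thesis
    using cohomology_closed zigzag_complexes[OF w(2)]
    by (intro linear_maps_cong[OF zigzag_cohomology_linear[OF w(2)]])
      (auto simp: w(1) dcohomology_dclass[OF w(2)])
qed

lemma dcohomology_comp:
  assumes "\<alpha> \<in> Hom (DVect K) X Y" "\<beta> \<in> Hom (DVect K) Y Z" "z \<in> carrier (cohomology X m)"
  shows "dcohomology m (dcomp K \<beta> \<alpha>) z = dcohomology m \<beta> (dcohomology m \<alpha> z)"
proof -
  obtain u v where w: "\<alpha> = dclass K X Y u" "zigzag K X Y u" "\<beta> = dclass K Y Z v" "zigzag K Y Z v"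
    using assms(1,2) by (elim Hom_DVectE)
  show ?thesis
    using w assms(3) linear_map_closed[OF zigzag_cohomology_linear[OF w(2)] assms(3)]
    by (simp add: dcomp_dclass dcohomology_dclass zigzag_append[OF w(2,4)] zigzag_cohomology_append)
qed

lemma dcohomology_ide:
  "is_complex K X \<Longrightarrow> z \<in> carrier (cohomology X m) \<Longrightarrow> dcohomology m (dclass K X X []) z = z"
  by (simp add: dcohomology_dclass zigzag.intros zigzag_cohomology_def)

lemma dcohomology_shift:
  assumes "\<alpha> \<in> Hom (DVect K) X Y" "z \<in> carrier (cohomology X (m + 1))"
  shows "dcohomology m (dshift K \<alpha>) z = dcohomology (m + 1) \<alpha> z"
proof -
  obtain w where w: "\<alpha> = dclass K X Y w" "zigzag K X Y w"
    using assms(1) by (rule Hom_DVectE)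
  have "is_complex K X"
    using zigzag_complexes[OF w(2)] by simp
  then show ?thesis
    using w(1) assms(2) zigzag_cohomology_shift[OF w(2)]
    by (simp add: dshift_dclass[OF w(2)] dcohomology_dclass[OF zigzag_shift[OF w(2)]]
        dcohomology_dclass[OF w(2)] cohomology_cshift)
qed

lemma dcohomology_dloc:
  assumes "is_complex K X" "is_complex K Y" "\<phi> \<in> chain_maps K X Y"
    and "z \<in> carrier (cohomology X m)"
  shows "dcohomology m (dloc K X Y \<phi>) z = cohomology_map Y m \<phi> z"
  using assms by (simp add: dloc_def dcohomology_dclass zigzag_Fwd zigzag_cohomology_def)

lemma dloc_Hom:
  "is_complex K X \<Longrightarrow> is_complex K Y \<Longrightarrow> \<phi> \<in> chain_maps K X Y \<Longrightarrow> dloc K X Y \<phi> \<in> Hom (DVect K) X Y"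
  by (auto simp: dloc_def Hom_DVect intro: zigzag_Fwd)

lemma dcohomology_iso_bij:
  assumes "\<alpha> \<in> isos (DVect K) X Y"
  shows "bij_betw (dcohomology m \<alpha>) (carrier (cohomology X m)) (carrier (cohomology Y m))"
proof -
  obtain \<alpha>' where \<alpha>: "\<alpha> \<in> Hom (DVect K) X Y" "\<alpha>' \<in> Hom (DVect K) Y X"
    "dcomp K \<alpha>' \<alpha> = dclass K X X []" "dcomp K \<alpha> \<alpha>' = dclass K Y Y []"
    using assms by (auto simp: isos_def)
  have c: "is_complex K X" "is_complex K Y"
    using Hom_DVect_complexes[OF \<alpha>(1)] by auto
  show ?thesis
  proof (rule bij_betwI[where g = "dcohomology m \<alpha>'"])
    show "dcohomology m \<alpha> \<in> carrier (cohomology X m) \<rightarrow> carrier (cohomology Y m)"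
      "dcohomology m \<alpha>' \<in> carrier (cohomology Y m) \<rightarrow> carrier (cohomology X m)"
      using \<alpha>(1,2) by (auto intro: linear_map_closed dcohomology_linear)
  qed (simp_all flip: dcohomology_comp[OF \<alpha>(1,2)] dcohomology_comp[OF \<alpha>(2,1)]
      add: \<alpha>(3,4) dcohomology_ide c)
qed
section \<open>Mapping cones and the long exact sequence\<close>

lemma cx_cone [simp]: "cx (cone X Y \<phi>) n = direct_sum (cx X (n + 1)) (cx Y n)"
  by (simp add: cone_def)

lemma diff_cone:
  "diff (cone X Y \<phi>) n s = Join (\<ominus>\<^bsub>cx X (n + 2)\<^esub> diff X (n + 1) (jfst s))
    (\<phi> (n + 1) (jfst s) \<oplus>\<^bsub>cx Y (n + 1)\<^esub> diff Y n (jsnd s))"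
  by (simp add: cone_def)

lemma Join_carrier_iff [simp]:
  "Join x y \<in> carrier (direct_sum V W) \<longleftrightarrow> x \<in> carrier V \<and> y \<in> carrier W"
  by (simp add: direct_sum_def)

lemma direct_sum_simps [simp]:
  "Join x y \<oplus>\<^bsub>direct_sum V W\<^esub> Join x' y' = Join (x \<oplus>\<^bsub>V\<^esub> x') (y \<oplus>\<^bsub>W\<^esub> y')"
  "a \<odot>\<^bsub>direct_sum V W\<^esub> Join x y = Join (a \<odot>\<^bsub>V\<^esub> x) (a \<odot>\<^bsub>W\<^esub> y)"
  "\<zero>\<^bsub>direct_sum V W\<^esub> = Join \<zero>\<^bsub>V\<^esub> \<zero>\<^bsub>W\<^esub>"
  by (simp_all add: direct_sum_def)

lemma direct_sum_carrierE:
  assumes "s \<in> carrier (direct_sum V W)"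
  obtains x y where "s = Join x y" "x \<in> carrier V" "y \<in> carrier W"
  using assms by (auto simp: direct_sum_def)

context
  fixes K :: "'k ring" and X Y :: "('k, 'u vect) cochain" and \<phi>
  assumes X: "is_complex K X" and Y: "is_complex K Y" and \<phi>: "\<phi> \<in> chain_maps K X Y"
begin

interpretation X: module K "cx X n" for n
  by (rule complex_module[OF X])

interpretation Y: module K "cx Y n" for n
  by (rule complex_module[OF Y])

lemma cx_minus_zero: "\<ominus>\<^bsub>cx X n\<^esub> \<zero>\<^bsub>cx X n\<^esub> = \<zero>\<^bsub>cx X n\<^esub>"
  by (rule X.minus_equality) auto

lemma diff_chain_map_zero:
  "diff X n \<zero>\<^bsub>cx X n\<^esub> = \<zero>\<^bsub>cx X (n + 1)\<^esub>" "diff Y n \<zero>\<^bsub>cx Y n\<^esub> = \<zero>\<^bsub>cx Y (n + 1)\<^esub>"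
  "\<phi> n \<zero>\<^bsub>cx X n\<^esub> = \<zero>\<^bsub>cx Y n\<^esub>"
  using linear_map_zero[OF X.module_axioms X.module_axioms complex_diff[OF X]]
    linear_map_zero[OF Y.module_axioms Y.module_axioms complex_diff[OF Y]]
    linear_map_zero[OF X.module_axioms Y.module_axioms chain_map_linear[OF \<phi>]] by blast+

lemma diff_chain_map_closed:
  "x \<in> carrier (cx X n) \<Longrightarrow> diff X n x \<in> carrier (cx X (n + 1))"
  "y \<in> carrier (cx Y n) \<Longrightarrow> diff Y n y \<in> carrier (cx Y (n + 1))"
  "x \<in> carrier (cx X n) \<Longrightarrow> \<phi> n x \<in> carrier (cx Y n)"
  using linear_map_closed[OF complex_diff[OF X]] linear_map_closed[OF complex_diff[OF Y]]
    linear_map_closed[OF chain_map_linear[OF \<phi>]] by blast+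

lemma cone_in_chain_maps: "cone_in X Y \<in> chain_maps K Y (cone X Y \<phi>)"
proof -
  have "diff X (n + 1) \<zero>\<^bsub>cx X (n + 1)\<^esub> = \<zero>\<^bsub>cx X (n + 2)\<^esub>" for n
    using diff_chain_map_zero(1)[of "n + 1"] by (simp add: add.assoc)
  then show ?thesis
    by (auto simp: chain_maps_def cone_in_def linear_maps_def diff_cone diff_chain_map_zero
        diff_chain_map_closed add.assoc cx_minus_zero)
qed

lemma cone_out_chain_maps:
  assumes "is_complex K (cone X Y \<phi>)"
  shows "cone_out X Y \<in> chain_maps K (cone X Y \<phi>) (cshift X)"
proof -
  \<comment> \<open>\<open>cone_out\<close> is restricted to the carrier, so it can be evaluated at
    a differential only once that is known to lie in the cone.\<close>
  have "diff (cone X Y \<phi>) n s \<in> carrier (direct_sum (cx X (n + 2)) (cx Y (n + 1)))"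
    if "s \<in> carrier (direct_sum (cx X (n + 1)) (cx Y n))" for n s
    using linear_map_closed[OF complex_diff[OF assms], of s n] that by (simp add: add.assoc)
  then show ?thesis
    by (auto simp: chain_maps_def cone_out_def linear_maps_def diff_cshift add.assoc
        elim!: direct_sum_carrierE) (simp_all add: diff_cone)
qed

text \<open>The first entry of the differential is \<open>- d x\<close>, whose sign does not affect
  vanishing.\<close>

lemma Join_cocycle_iff:
  "Join x y \<in> cocycles (cone X Y \<phi>) m \<longleftrightarrow>
    x \<in> cocycles X (m + 1) \<and> y \<in> carrier (cx Y m) \<and>
    \<phi> (m + 1) x \<oplus>\<^bsub>cx Y (m + 1)\<^esub> diff Y m y = \<zero>\<^bsub>cx Y (m + 1)\<^esub>"
proof -
  have "diff X (m + 1) x \<in> carrier (cx X (m + 2))" if "x \<in> carrier (cx X (m + 1))"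
    using diff_chain_map_closed(1)[OF that] by (simp add: add.assoc)
  then show ?thesis
    by (auto simp: cocycles_def diff_cone add.assoc)
qed

text \<open>Here the sign has to stay, as the same \<open>x'\<close> also enters the second
  entry.\<close>

lemma Join_coboundary_iff:
  "Join x y \<in> coboundaries (cone X Y \<phi>) m \<longleftrightarrow>
    (\<exists>x' \<in> carrier (cx X m). \<exists>y' \<in> carrier (cx Y (m - 1)).
      x = \<ominus>\<^bsub>cx X (m + 1)\<^esub> diff X m x' \<and> y = \<phi> m x' \<oplus>\<^bsub>cx Y m\<^esub> diff Y (m - 1) y')"
proof
  assume "Join x y \<in> coboundaries (cone X Y \<phi>) m"
  then obtain s where s: "s \<in> carrier (direct_sum (cx X m) (cx Y (m - 1)))"
      "Join x y = diff (cone X Y \<phi>) (m - 1) s"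
    by (auto simp: coboundaries_def)
  from s(1) obtain x' y' where "s = Join x' y'" "x' \<in> carrier (cx X m)"
      "y' \<in> carrier (cx Y (m - 1))"
    by (rule direct_sum_carrierE)
  with s(2) show "\<exists>x' \<in> carrier (cx X m). \<exists>y' \<in> carrier (cx Y (m - 1)).
      x = \<ominus>\<^bsub>cx X (m + 1)\<^esub> diff X m x' \<and> y = \<phi> m x' \<oplus>\<^bsub>cx Y m\<^esub> diff Y (m - 1) y'"
    by (auto simp: diff_cone add.commute)
next
  assume "\<exists>x' \<in> carrier (cx X m). \<exists>y' \<in> carrier (cx Y (m - 1)).
      x = \<ominus>\<^bsub>cx X (m + 1)\<^esub> diff X m x' \<and> y = \<phi> m x' \<oplus>\<^bsub>cx Y m\<^esub> diff Y (m - 1) y'"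
  then obtain x' y' where "x' \<in> carrier (cx X m)" "y' \<in> carrier (cx Y (m - 1))"
      "x = \<ominus>\<^bsub>cx X (m + 1)\<^esub> diff X m x'" "y = \<phi> m x' \<oplus>\<^bsub>cx Y m\<^esub> diff Y (m - 1) y'"
    by blast
  then show "Join x y \<in> coboundaries (cone X Y \<phi>) m"
    unfolding coboundaries_def
    by (intro image_eqI[of _ _ "Join x' y'"]) (auto simp: diff_cone add.commute)
qed

text \<open>For a cocycle \<open>x\<close>, the pair \<open>(0, \<phi> x)\<close> is the
  differential of \<open>(x, 0)\<close>. Conversely, if \<open>(0, y)\<close> is the differential of
  \<open>(x', y')\<close>, then \<open>d x' = 0\<close> and
  \<open>y = \<phi> x' + d y'\<close>.\<close>

lemma cone_in_exact:
  assumes Z: "is_complex K (cone X Y \<phi>)"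
  shows "exact_at K (cohomology X m) (cohomology_map Y m \<phi>) (cohomology Y m)
    (cohomology_map (cone X Y \<phi>) m (cone_in X Y)) (cohomology (cone X Y \<phi>) m)"
proof (rule cohomology_exact_atI[OF X Y Z \<phi> cone_in_chain_maps])
  fix x assume x: "x \<in> cocycles X m"
  then have "Join \<zero>\<^bsub>cx X (m + 1)\<^esub> (\<phi> m x) \<in> coboundaries (cone X Y \<phi>) m"
    unfolding Join_coboundary_iff using diff_chain_map_zero(2)[of "m - 1"]
    by (intro bexI[of _ x] bexI[of _ "\<zero>\<^bsub>cx Y (m - 1)\<^esub>"])
      (auto simp: cocycles_def cx_minus_zero diff_chain_map_closed)
  then show "cone_in X Y m (\<phi> m x) \<in> coboundaries (cone X Y \<phi>) m"
    using cocycle_carrier[OF x] by (simp add: cone_in_def diff_chain_map_closed)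
next
  fix y assume y: "y \<in> cocycles Y m" "cone_in X Y m y \<in> coboundaries (cone X Y \<phi>) m"
  then obtain x' y' where *: "x' \<in> carrier (cx X m)" "y' \<in> carrier (cx Y (m - 1))"
      "\<zero>\<^bsub>cx X (m + 1)\<^esub> = \<ominus>\<^bsub>cx X (m + 1)\<^esub> diff X m x'" "y = \<phi> m x' \<oplus>\<^bsub>cx Y m\<^esub> diff Y (m - 1) y'"
    by (auto simp: cone_in_def cocycles_def Join_coboundary_iff)
  have "diff X m x' = \<zero>\<^bsub>cx X (m + 1)\<^esub>"
    using *(3) diff_chain_map_closed(1)[OF *(1)] by (metis X.minus_minus cx_minus_zero)
  moreover have "diff Y (m - 1) y' \<in> carrier (cx Y m)"
    using diff_chain_map_closed(2)[OF *(2)] by simp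
  ultimately show "\<exists>x \<in> cocycles X m. \<exists>b \<in> coboundaries Y m. y = b \<oplus>\<^bsub>cx Y m\<^esub> \<phi> m x"
    using * diff_chain_map_closed(3)[OF *(1)]
    by (intro bexI[of _ x'] bexI[of _ "diff Y (m - 1) y'"])
      (auto simp: cocycles_def coboundaries_def Y.a_comm)
qed

text \<open>The composite is zero already on cochains. Conversely, a cocycle \<open>(x, y)\<close>
  with \<open>x = d x'\<close> is moved into the image of \<open>Y\<close> by a coboundary that
  cancels its first entry.\<close>

lemma cone_out_exact:
  assumes Z: "is_complex K (cone X Y \<phi>)"
  shows "exact_at K (cohomology Y m) (cohomology_map (cone X Y \<phi>) m (cone_in X Y))
    (cohomology (cone X Y \<phi>) m) (cohomology_map (cshift X) m (cone_out X Y))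
    (cohomology (cshift X) m)"
proof (rule cohomology_exact_atI[OF Y Z is_complex_cshift[OF X] cone_in_chain_maps
      cone_out_chain_maps[OF Z]])
  fix y assume "y \<in> cocycles Y m"
  then show "cone_out X Y m (cone_in X Y m y) \<in> coboundaries (cshift X) m"
    using diff_chain_map_zero(1)[of m]
    by (auto simp: cone_in_def cone_out_def cocycles_def coboundary_cshift_iff[OF X]
        intro!: bexI[of _ "\<zero>\<^bsub>cx X m\<^esub>"])
next
  fix s assume s: "s \<in> cocycles (cone X Y \<phi>) m" "cone_out X Y m s \<in> coboundaries (cshift X) m"
  obtain x y where xy: "s = Join x y" "x \<in> carrier (cx X (m + 1))" "y \<in> carrier (cx Y m)"
    using cocycle_carrier[OF s(1)] by (auto elim: direct_sum_carrierE)
  obtain x' where x': "x' \<in> carrier (cx X m)" "x = diff X m x'"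
    using s(2) xy by (auto simp: cone_out_def coboundary_cshift_iff[OF X])
  \<comment> \<open>\<open>?b\<close> is the differential of \<open>(- x', 0)\<close>. Subtracting
    it from \<open>s\<close> leaves \<open>(0, ?y)\<close>, and \<open>?y\<close> is a cocycle
    because \<open>\<phi> x + d y = 0\<close>.\<close>
  let ?y = "y \<oplus>\<^bsub>cx Y m\<^esub> \<phi> m x'" and ?b = "Join x (\<ominus>\<^bsub>cx Y m\<^esub> \<phi> m x')"
  note \<phi>x' = diff_chain_map_closed(3)[OF x'(1)]
  have "diff Y m ?y = diff Y m y \<oplus>\<^bsub>cx Y (m + 1)\<^esub> \<phi> (m + 1) x"
    using linear_map_add[OF complex_diff[OF Y] xy(3) \<phi>x'] chain_map_diff[OF \<phi> x'(1)] x'(2)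
    by simp
  also have "\<dots> = \<zero>\<^bsub>cx Y (m + 1)\<^esub>"
    using s(1) xy diff_chain_map_closed by (simp add: Join_cocycle_iff Y.a_comm)
  finally have "?y \<in> cocycles Y m"
    using xy \<phi>x' by (simp add: cocycles_def)
  moreover have "?b \<in> coboundaries (cone X Y \<phi>) m"
    unfolding Join_coboundary_iff
  proof (intro bexI conjI)
    show "x = \<ominus>\<^bsub>cx X (m + 1)\<^esub> diff X m (\<ominus>\<^bsub>cx X m\<^esub> x')"
      using x' diff_chain_map_closed(1)[OF x'(1)]
        linear_map_minus[OF X.module_axioms X.module_axioms complex_diff[OF X] x'(1)] by simp
    show "\<ominus>\<^bsub>cx Y m\<^esub> \<phi> m x' =
        \<phi> m (\<ominus>\<^bsub>cx X m\<^esub> x') \<oplus>\<^bsub>cx Y m\<^esub> diff Y (m - 1) \<zero>\<^bsub>cx Y (m - 1)\<^esub>"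
      using \<phi>x' diff_chain_map_zero(2)[of "m - 1"]
        linear_map_minus[OF X.module_axioms Y.module_axioms chain_map_linear[OF \<phi>] x'(1)] by simp
  qed (use x' in auto)
  moreover have "s = ?b \<oplus>\<^bsub>cx (cone X Y \<phi>) m\<^esub> cone_in X Y m ?y"
    using xy \<phi>x' by (simp add: cone_in_def Y.a_lcomm Y.l_neg)
  ultimately show "\<exists>y \<in> cocycles Y m. \<exists>b \<in> coboundaries (cone X Y \<phi>) m.
      s = b \<oplus>\<^bsub>cx (cone X Y \<phi>) m\<^esub> cone_in X Y m y"
    by blast
qed

text \<open>In a cocycle \<open>(x, y)\<close> of the cone, \<open>- y\<close> is a primitive of
  \<open>\<phi> x\<close>; conversely a primitive of \<open>\<phi> x\<close> completes
  \<open>x\<close> to a cocycle. The criterion wants all maps in one degree, so the argument runs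
  with \<open>chain_shift \<phi>\<close> and is rewritten at the end.\<close>

lemma cone_shift_exact:
  assumes Z: "is_complex K (cone X Y \<phi>)"
  shows "exact_at K (cohomology (cone X Y \<phi>) m) (cohomology_map (cshift X) m (cone_out X Y))
    (cohomology X (m + 1)) (cohomology_map Y (m + 1) \<phi>) (cohomology Y (m + 1))"
proof -
  have "exact_at K (cohomology (cone X Y \<phi>) m) (cohomology_map (cshift X) m (cone_out X Y))
    (cohomology (cshift X) m) (cohomology_map (cshift Y) m (chain_shift \<phi>)) (cohomology (cshift Y) m)"
  proof (rule cohomology_exact_atI[OF Z is_complex_cshift[OF X] is_complex_cshift[OF Y]
        cone_out_chain_maps[OF Z] chain_shift_chain_maps[OF X Y \<phi>]])
    fix s assume s: "s \<in> cocycles (cone X Y \<phi>) m"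
    obtain x y where xy: "s = Join x y" "x \<in> carrier (cx X (m + 1))" "y \<in> carrier (cx Y m)"
      using cocycle_carrier[OF s] by (auto elim: direct_sum_carrierE)
    have "\<phi> (m + 1) x = \<ominus>\<^bsub>cx Y (m + 1)\<^esub> diff Y m y"
      using s xy diff_chain_map_closed by (intro Y.minus_equality[symmetric]) (auto simp: Join_cocycle_iff)
    also have "\<dots> = diff Y m (\<ominus>\<^bsub>cx Y m\<^esub> y)"
      using linear_map_minus[OF Y.module_axioms Y.module_axioms complex_diff[OF Y] xy(3)] by simp
    finally show "chain_shift \<phi> m (cone_out X Y m s) \<in> coboundaries (cshift Y) m"
      using xy by (auto simp: chain_shift_def cone_out_def coboundary_cshift_iff[OF Y])
  next
    fix x assume x: "x \<in> cocycles (cshift X) m" "chain_shift \<phi> m x \<in> coboundaries (cshift Y) m"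
    then obtain y where y: "y \<in> carrier (cx Y m)" "\<phi> (m + 1) x = diff Y m y"
      by (auto simp: chain_shift_def coboundary_cshift_iff[OF Y])
    have x': "x \<in> cocycles X (m + 1)"
      using x(1) by (simp add: cocycles_cshift[OF X])
    \<comment> \<open>The primitive enters negated because the second entry of the differential is
      \<open>\<phi> x\<close> plus, not minus, the differential of the second component.\<close>
    have "Join x (\<ominus>\<^bsub>cx Y m\<^esub> y) \<in> cocycles (cone X Y \<phi>) m"
      unfolding Join_cocycle_iff
      using x' y linear_map_minus[OF Y.module_axioms Y.module_axioms complex_diff[OF Y] y(1)]
        diff_chain_map_closed(2)[OF y(1)] by (simp add: Y.r_neg)
    moreover have "x = \<zero>\<^bsub>cx X (m + 1)\<^esub> \<oplus>\<^bsub>cx X (m + 1)\<^esub> cone_out X Y m (Join x (\<ominus>\<^bsub>cx Y m\<^esub> y))"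
      using cocycle_carrier[OF x'] y(1) by (simp add: cone_out_def)
    moreover have "\<zero>\<^bsub>cx X (m + 1)\<^esub> \<in> coboundaries (cshift X) m"
      using diff_chain_map_zero(1)[of m, symmetric]
      by (auto simp: coboundary_cshift_iff[OF X] intro!: bexI[of _ "\<zero>\<^bsub>cx X m\<^esub>"])
    ultimately show "\<exists>s \<in> cocycles (cone X Y \<phi>) m. \<exists>b \<in> coboundaries (cshift X) m.
        x = b \<oplus>\<^bsub>cx (cshift X) m\<^esub> cone_out X Y m s"
      unfolding cx_cshift by blast
  qed
  then show ?thesis
    by (simp add: cohomology_cshift[OF X] cohomology_cshift[OF Y] cohomology_map_cshift[OF Y])
qed

end

text \<open>\<open>\<gamma>\<close> detects zero, so \<open>g y\<close> vanishes iff
  \<open>\<beta> y\<close> lies in the image of \<open>f'\<close>. That image is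
  \<open>\<beta>\<close> applied to the image of \<open>f\<close>, as \<open>\<alpha>\<close> is
  onto, and \<open>\<beta>\<close> is injective.\<close>

lemma exact_at_transport:
  assumes "exact_at K U' f' V' g' W'" "f \<in> linear_maps K U V" "g \<in> linear_maps K V W"
    and \<alpha>: "bij_betw \<alpha> (carrier U) (carrier U')" and \<beta>: "bij_betw \<beta> (carrier V) (carrier V')"
    and \<gamma>: "inj_on \<gamma> (carrier W)" "\<zero>\<^bsub>W\<^esub> \<in> carrier W" "\<gamma> \<zero>\<^bsub>W\<^esub> = \<zero>\<^bsub>W'\<^esub>"
    and f: "\<And>x. x \<in> carrier U \<Longrightarrow> \<beta> (f x) = f' (\<alpha> x)"
    and g: "\<And>y. y \<in> carrier V \<Longrightarrow> \<gamma> (g y) = g' (\<beta> y)"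
  shows "exact_at K U f V g W"
proof -
  have "g y = \<zero>\<^bsub>W\<^esub> \<longleftrightarrow> y \<in> f ` carrier U" if y: "y \<in> carrier V" for y
  proof -
    have "g y = \<zero>\<^bsub>W\<^esub> \<longleftrightarrow> g' (\<beta> y) = \<zero>\<^bsub>W'\<^esub>"
      using inj_on_eq_iff[OF \<gamma>(1) linear_map_closed[OF assms(3) y] \<gamma>(2)] g[OF y] \<gamma>(3) by simp
    also have "\<dots> \<longleftrightarrow> \<beta> y \<in> f' ` carrier U'"
      using assms(1) \<beta> y by (auto simp: exact_at_def bij_betw_def)
    also have "f' ` carrier U' = \<beta> ` f ` carrier U"
      using \<alpha> f by (simp add: image_image flip: bij_betw_imp_surj_on[OF \<alpha>] cong: image_cong)
    also have "\<beta> y \<in> \<beta> ` f ` carrier U \<longleftrightarrow> y \<in> f ` carrier U"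
      using \<beta> y linear_map_closed[OF assms(2)]
      by (intro inj_on_image_mem_iff[of _ "carrier V"]) (auto simp: bij_betw_def)
    finally show ?thesis .
  qed
  then show ?thesis
    using assms(2,3) linear_map_closed[OF assms(2)] by (auto simp: exact_at_def)
qed

lemma DVect_dist_long_exact:
  assumes dist: "(a, b, c) \<in> dist (DVect K)"
    and a: "a \<in> Hom (DVect K) A B" and b: "b \<in> Hom (DVect K) B C"
    and c: "c \<in> Hom (DVect K) C (cshift A)"
  shows "long_exact K A B C a b c"
proof -
  obtain X Y \<phi> where X: "is_complex K X" and Y: "is_complex K Y" and \<phi>: "\<phi> \<in> chain_maps K X Y"
    and "tri_isomorphic (DVect_pre K) (a, b, c) (cone_triangle K X Y \<phi>)"
    using dist by (auto simp: DVect_def)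
  then obtain u v w where u: "u \<in> isos (DVect K) A X" and v: "v \<in> isos (DVect K) B Y"
    and w: "w \<in> isos (DVect K) C (cone X Y \<phi>)"
    and sq: "dcomp K v a = dcomp K (dloc K X Y \<phi>) u"
      "dcomp K w b = dcomp K (dloc K Y (cone X Y \<phi>) (cone_in X Y)) v"
      "dcomp K (dshift K u) c = dcomp K (dloc K (cone X Y \<phi>) (cshift X) (cone_out X Y)) w"
    by (auto simp: tri_isomorphic_def cone_triangle_def isos_DVect_pre fst_Hom_DVect[OF a]
        fst_Hom_DVect[OF b] fst_Hom_DVect[OF c] dloc_def dclass_def)
  have uh: "u \<in> Hom (DVect K) A X" and vh: "v \<in> Hom (DVect K) B Y"
    and wh: "w \<in> Hom (DVect K) C (cone X Y \<phi>)"
    using u v w by (auto simp: isos_def)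
  \<comment> \<open>The target of an arrow is a complex, so \<open>w\<close> spares a proof that the cone is one.\<close>
  have A: "is_complex K A" and B: "is_complex K B" and C: "is_complex K C"
    and Z: "is_complex K (cone X Y \<phi>)"
    using Hom_DVect_complexes uh vh wh by blast+
  note sX = is_complex_cshift[OF X]
  note i = cone_in_chain_maps[OF X Y \<phi>] and o = cone_out_chain_maps[OF X Y \<phi> Z]
  have H: "cohomology (cshift A) m = cohomology A (m + 1)"
    "cohomology (cshift X) m = cohomology X (m + 1)" for m
    by (rule cohomology_cshift[OF A] cohomology_cshift[OF X])+
  have clin: "dcohomology m c \<in> linear_maps K (cohomology C m) (cohomology A (m + 1))" for m
    using dcohomology_linear[OF c] by (simp add: H)
  note bij = dcohomology_iso_bij
  note inj = bij_betw_imp_inj_on[OF bij]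
  note zero = cohomology_closed(3) cohomology_linear_map_zero
  have sq1: "dcohomology m v (dcohomology m a z) = cohomology_map Y m \<phi> (dcohomology m u z)"
    if "z \<in> carrier (cohomology A m)" for m z
    using dcohomology_comp[OF a vh that] dcohomology_comp[OF uh dloc_Hom[OF X Y \<phi>] that]
      dcohomology_dloc[OF X Y \<phi> linear_map_closed[OF dcohomology_linear[OF uh] that]] sq(1) by simp
  have sq2: "dcohomology m w (dcohomology m b z) =
      cohomology_map (cone X Y \<phi>) m (cone_in X Y) (dcohomology m v z)"
    if "z \<in> carrier (cohomology B m)" for m z
    using dcohomology_comp[OF b wh that] dcohomology_comp[OF vh dloc_Hom[OF Y Z i] that]
      dcohomology_dloc[OF Y Z i linear_map_closed[OF dcohomology_linear[OF vh] that]] sq(2) by simp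
  \<comment> \<open>The vertical arrow at the end of the triangle is \<open>dshift K u\<close>,
    which acts in degree \<open>m\<close> as \<open>u\<close> does in degree \<open>m + 1\<close>.
    This joins the ladders of consecutive degrees.\<close>
  have sq3: "dcohomology (m + 1) u (dcohomology m c z) =
      cohomology_map (cshift X) m (cone_out X Y) (dcohomology m w z)"
    if "z \<in> carrier (cohomology C m)" for m z
    using dcohomology_comp[OF c dshift_Hom[OF uh] that] dcohomology_comp[OF wh dloc_Hom[OF Z sX o] that]
      dcohomology_dloc[OF Z sX o linear_map_closed[OF dcohomology_linear[OF wh] that]] sq(3)
      dcohomology_shift[OF uh linear_map_closed[OF clin that]] by simp
  show ?thesis
    unfolding long_exact_def
  proof (intro allI conjI)
    fix m
    show "exact_at K (cohomology A m) (dcohomology m a) (cohomology B m) (dcohomology m b) (cohomology C m)"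
      by (rule exact_at_transport[OF cone_in_exact[OF X Y \<phi> Z] dcohomology_linear[OF a]
            dcohomology_linear[OF b] bij[OF u] bij[OF v] inj[OF w] zero(1)[OF C]
            zero(2)[OF C Z dcohomology_linear[OF wh]] sq1 sq2])
    show "exact_at K (cohomology B m) (dcohomology m b) (cohomology C m) (dcohomology m c) (cohomology A (m + 1))"
      by (rule exact_at_transport[where \<alpha> = "dcohomology m v" and \<beta> = "dcohomology m w"
            and \<gamma> = "dcohomology (m + 1) u", OF cone_out_exact[OF X Y \<phi> Z, where m = m, unfolded H]
            dcohomology_linear[OF b] clin bij[OF v] bij[OF w] inj[OF u, of "m + 1"]
            zero(1)[OF A] zero(2)[OF A X dcohomology_linear[OF uh]] sq2 sq3])
    \<comment> \<open>The ladder crosses degrees here: after \<open>sq3\<close> the square on the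
      right is \<open>sq1\<close> in degree \<open>m + 1\<close>.\<close>
    show "exact_at K (cohomology C m) (dcohomology m c) (cohomology A (m + 1)) (dcohomology (m + 1) a)
        (cohomology B (m + 1))"
      by (rule exact_at_transport[where \<alpha> = "dcohomology m w" and \<beta> = "dcohomology (m + 1) u"
            and \<gamma> = "dcohomology (m + 1) v", OF cone_shift_exact[OF X Y \<phi> Z, where m = m]
            clin dcohomology_linear[OF a] bij[OF w] bij[OF u] inj[OF v, of "m + 1"]
            zero(1)[OF B] zero(2)[OF B Y dcohomology_linear[OF vh]] sq3 sq1])
  qed
qed

section \<open>Composition of exact functors\<close>

lemma (in lin_additive_category) Hom_obs:
  "f \<in> Hom C X Y \<Longrightarrow> X \<in> obs C \<and> Y \<in> obs C"
  using src_tgt by (auto simp: Hom_def)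

lemma exact_functorD:
  assumes "exact_functor C D F"
  shows "X \<in> obs C \<Longrightarrow> onO F X \<in> obs D"
    and "\<lbrakk>X \<in> obs C; Y \<in> obs C; f \<in> Hom C X Y\<rbrakk> \<Longrightarrow> onM F f \<in> Hom D (onO F X) (onO F Y)"
    and "X \<in> obs C \<Longrightarrow> onM F (ide C X) = ide D (onO F X)"
    and "\<lbrakk>X \<in> obs C; Y \<in> obs C; Z \<in> obs C; f \<in> Hom C X Y; g \<in> Hom C Y Z\<rbrakk> \<Longrightarrow>
      onM F (g \<cdot>\<^bsub>C\<^esub> f) = onM F g \<cdot>\<^bsub>D\<^esub> onM F f"
    and "X \<in> obs C \<Longrightarrow> shiso F X \<in> isos D (onO F (shO C X)) (shO D (onO F X))"
    and "\<lbrakk>X \<in> obs C; Y \<in> obs C; f \<in> Hom C X Y\<rbrakk> \<Longrightarrow>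
      shiso F Y \<cdot>\<^bsub>D\<^esub> onM F (shM C f) = shM D (onM F f) \<cdot>\<^bsub>D\<^esub> shiso F X"
    and "(f, g, h) \<in> dist C \<Longrightarrow>
      (onM F f, onM F g, shiso F (src C f) \<cdot>\<^bsub>D\<^esub> onM F h) \<in> dist D"
  using assms unfolding exact_functor_def by blast+

lemma contra_exact_functorD:
  assumes "contra_exact_functor C D F"
  shows "X \<in> obs C \<Longrightarrow> onO F X \<in> obs D"
    and "\<lbrakk>X \<in> obs C; Y \<in> obs C; f \<in> Hom C X Y\<rbrakk> \<Longrightarrow> onM F f \<in> Hom D (onO F Y) (onO F X)"
    and "X \<in> obs C \<Longrightarrow> onM F (ide C X) = ide D (onO F X)"
    and "\<lbrakk>X \<in> obs C; Y \<in> obs C; Z \<in> obs C; f \<in> Hom C X Y; g \<in> Hom C Y Z\<rbrakk> \<Longrightarrow>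
      onM F (g \<cdot>\<^bsub>C\<^esub> f) = onM F f \<cdot>\<^bsub>D\<^esub> onM F g"
    and "X \<in> obs C \<Longrightarrow> shiso F X \<in> isos D (onO F X) (shO D (onO F (shO C X)))"
    and "\<lbrakk>X \<in> obs C; Y \<in> obs C; f \<in> Hom C X Y\<rbrakk> \<Longrightarrow>
      shM D (onM F (shM C f)) \<cdot>\<^bsub>D\<^esub> shiso F Y = shiso F X \<cdot>\<^bsub>D\<^esub> onM F f"
    and "(f, g, h) \<in> dist C \<Longrightarrow>
      (onM F g, onM F f, shM D (onM F h) \<cdot>\<^bsub>D\<^esub> shiso F (src C f)) \<in> dist D"
  using assms unfolding contra_exact_functor_def by blast+

lemma isosD: "f \<in> isos C X Y \<Longrightarrow> f \<in> Hom C X Y"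
  by (simp add: isos_def)

lemma exact_functor_isos:
  assumes "exact_functor C D F" "X \<in> obs C" "Y \<in> obs C" "f \<in> isos C X Y"
  shows "onM F f \<in> isos D (onO F X) (onO F Y)"
proof -
  note F = exact_functorD[OF assms(1)]
  obtain g where g: "g \<in> Hom C Y X" "g \<cdot>\<^bsub>C\<^esub> f = ide C X" "f \<cdot>\<^bsub>C\<^esub> g = ide C Y"
    using assms(4) by (auto simp: isos_def)
  note f = isosD[OF assms(4)]
  show ?thesis
    using F(2)[OF assms(2,3) f] F(2)[OF assms(3,2) g(1)] g(2,3) F(3)[OF assms(2)] F(3)[OF assms(3)]
      F(4)[OF assms(2,3,2) f g(1)] F(4)[OF assms(3,2,3) g(1) f]
    by (auto simp: isos_def)
qed

lemma contra_exact_functor_isos: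
  assumes "contra_exact_functor C D F" "X \<in> obs C" "Y \<in> obs C" "f \<in> isos C X Y"
  shows "onM F f \<in> isos D (onO F Y) (onO F X)"
proof -
  note F = contra_exact_functorD[OF assms(1)]
  obtain g where g: "g \<in> Hom C Y X" "g \<cdot>\<^bsub>C\<^esub> f = ide C X" "f \<cdot>\<^bsub>C\<^esub> g = ide C Y"
    using assms(4) by (auto simp: isos_def)
  note f = isosD[OF assms(4)]
  show ?thesis
    using F(2)[OF assms(2,3) f] F(2)[OF assms(3,2) g(1)] g(2,3) F(3)[OF assms(2)] F(3)[OF assms(3)]
      F(4)[OF assms(2,3,2) f g(1)] F(4)[OF assms(3,2,3) g(1) f]
    by (auto simp: isos_def)
qed

context lin_triangulated_category
begin

lemma shO_obs: "X \<in> obs C \<Longrightarrow> shO C X \<in> obs C"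
  using shO_bij by (auto simp: bij_betw_def)

lemma distE:
  assumes "(f, g, h) \<in> dist C"
  obtains X Y Z where "X \<in> obs C" "Y \<in> obs C" "Z \<in> obs C"
    "f \<in> Hom C X Y" "g \<in> Hom C Y Z" "h \<in> Hom C Z (shO C X)" "src C f = X"
  using assms dist_triangles by (fastforce simp: triangles_def Hom_def)

end

text \<open>The comparison runs \<open>G(F(X[1])) \<rightarrow> G((F X)[1]) \<rightarrow> (G(F
  X))[1]\<close>. Its naturality pastes the image under \<open>G\<close> of the square for
  \<open>F\<close> to the square for \<open>G\<close> at \<open>onM F f\<close>. On triangles,
  \<open>G\<close> splits the connecting arrow produced by \<open>F\<close>, and reassociating gives
  the required one.\<close>

lemma exact_functor_comp:
  assumes "lin_triangulated_category K C" "lin_triangulated_category K D"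
    "lin_triangulated_category K E"
    and "exact_functor C D F" "exact_functor D E G"
  shows "exact_functor C E (tri_comp E G F)"
proof -
  interpret C: lin_triangulated_category K C by fact
  interpret D: lin_triangulated_category K D by fact
  interpret E: lin_triangulated_category K E by fact
  note F = exact_functorD[OF assms(4)] and G = exact_functorD[OF assms(5)]
  have iso: "shiso G (onO F X) \<cdot>\<^bsub>E\<^esub> onM G (shiso F X)
      \<in> isos E (onO G (onO F (shO C X))) (shO E (onO G (onO F X)))" if X: "X \<in> obs C" for X
    by (rule E.isos_comp[OF exact_functor_isos[OF assms(5) F(1)[OF C.shO_obs[OF X]]
            D.shO_obs[OF F(1)[OF X]] F(5)[OF X]] G(5)[OF F(1)[OF X]]])
  have nat: "(shiso G (onO F Y) \<cdot>\<^bsub>E\<^esub> onM G (shiso F Y)) \<cdot>\<^bsub>E\<^esub> onM G (onM F (shM C f)) =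
      shM E (onM G (onM F f)) \<cdot>\<^bsub>E\<^esub> (shiso G (onO F X) \<cdot>\<^bsub>E\<^esub> onM G (shiso F X))"
    if f: "f \<in> Hom C X Y" for X Y f
  proof -
    have X: "X \<in> obs C" "Y \<in> obs C" using C.Hom_obs[OF f] by auto
    note sX = X[THEN C.shO_obs] and FX = X[THEN F(1)]
    note sFX = FX[THEN D.shO_obs] and FsX = sX[THEN F(1)]
    note Ff = F(2)[OF X f] and Fsf = F(2)[OF sX C.shM_hom[OF f]]
    note sF = X[THEN F(5), THEN isosD] and sG = FX[THEN G(5), THEN isosD]
    note GsF = G(2)[OF FsX(1) sFX(1) sF(1)] G(2)[OF FsX(2) sFX(2) sF(2)]
    have "(shiso G (onO F Y) \<cdot>\<^bsub>E\<^esub> onM G (shiso F Y)) \<cdot>\<^bsub>E\<^esub> onM G (onM F (shM C f)) =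
        shiso G (onO F Y) \<cdot>\<^bsub>E\<^esub> (onM G (shiso F Y) \<cdot>\<^bsub>E\<^esub> onM G (onM F (shM C f)))"
      by (rule E.cmp_assoc[OF G(2)[OF FsX Fsf] GsF(2) sG(2), symmetric])
    also have "\<dots> = shiso G (onO F Y) \<cdot>\<^bsub>E\<^esub> onM G (shiso F Y \<cdot>\<^bsub>D\<^esub> onM F (shM C f))"
      by (simp only: G(4)[OF FsX sFX(2) Fsf sF(2)])
    also have "\<dots> = shiso G (onO F Y) \<cdot>\<^bsub>E\<^esub> (onM G (shM D (onM F f)) \<cdot>\<^bsub>E\<^esub> onM G (shiso F X))"
      by (simp only: F(6)[OF X f] G(4)[OF FsX(1) sFX sF(1) D.shM_hom[OF Ff]])
    also have "\<dots> = (shiso G (onO F Y) \<cdot>\<^bsub>E\<^esub> onM G (shM D (onM F f))) \<cdot>\<^bsub>E\<^esub> onM G (shiso F X)"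
      by (rule E.cmp_assoc[OF GsF(1) G(2)[OF sFX D.shM_hom[OF Ff]] sG(2)])
    also have "\<dots> = (shM E (onM G (onM F f)) \<cdot>\<^bsub>E\<^esub> shiso G (onO F X)) \<cdot>\<^bsub>E\<^esub> onM G (shiso F X)"
      by (simp only: G(6)[OF FX Ff])
    also have "\<dots> = shM E (onM G (onM F f)) \<cdot>\<^bsub>E\<^esub> (shiso G (onO F X) \<cdot>\<^bsub>E\<^esub> onM G (shiso F X))"
      by (rule E.cmp_assoc[OF GsF(1) sG(1) E.shM_hom[OF G(2)[OF FX Ff]], symmetric])
    finally show ?thesis .
  qed
  have dist: "(onM G (onM F f), onM G (onM F g),
      (shiso G (onO F (src C f)) \<cdot>\<^bsub>E\<^esub> onM G (shiso F (src C f))) \<cdot>\<^bsub>E\<^esub> onM G (onM F h)) \<in> dist E"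
    if fgh: "(f, g, h) \<in> dist C" for f g h
  proof -
    obtain X Y Z where X: "X \<in> obs C" and Y: "Y \<in> obs C" and Z: "Z \<in> obs C"
      and f: "f \<in> Hom C X Y" and h: "h \<in> Hom C Z (shO C X)" "src C f = X"
      using fgh by (rule C.distE)
    note FX = F(1)[OF X] and FsX = F(1)[OF C.shO_obs[OF X]] and FZ = F(1)[OF Z]
    note sFX = D.shO_obs[OF FX]
    note Fh = F(2)[OF Z C.shO_obs[OF X] h(1)] and sF = isosD[OF F(5)[OF X]]
    \<comment> \<open>Exactness of \<open>G\<close> places its comparison at the source of the first
      arrow of the image triangle, which has to be identified.\<close>
    have "src D (onM F f) = onO F X"
      using F(2)[OF X Y f] by (simp add: Hom_def)
    then show ?thesis
      using G(7)[OF F(7)[OF fgh]] h(2) G(4)[OF FZ FsX sFX Fh sF]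
        E.cmp_assoc[OF G(2)[OF FZ FsX Fh] G(2)[OF FsX sFX sF] isosD[OF G(5)[OF FX]]]
      by simp
  qed
  have comp: "onM G (onM F (g \<cdot>\<^bsub>C\<^esub> f)) = onM G (onM F g) \<cdot>\<^bsub>E\<^esub> onM G (onM F f)"
    if fg: "f \<in> Hom C X Y" "g \<in> Hom C Y Z" for X Y Z f g
  proof -
    have X: "X \<in> obs C" "Y \<in> obs C" "Z \<in> obs C"
      using C.Hom_obs[OF fg(1)] C.Hom_obs[OF fg(2)] by auto
    show ?thesis
      unfolding F(4)[OF X fg]
      by (rule G(4)[OF F(1)[OF X(1)] F(1)[OF X(2)] F(1)[OF X(3)] F(2)[OF X(1,2) fg(1)]
            F(2)[OF X(2,3) fg(2)]])
  qed
  show ?thesis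
    unfolding exact_functor_def tri_comp_def
    using F(1-3) G(1-3) iso comp nat dist by simp
qed

text \<open>The same pasting as in the covariant case, but \<open>P\<close> reverses the square of
  \<open>F\<close> and everything coming from \<open>F\<close> sits under a shift, so functoriality
  of \<open>dshift\<close> is used as well. The record is written out in the form to which
  \<open>interaction_simps\<close> reduces the interaction profunctor.\<close>

lemma contra_exact_functor_comp:
  assumes "lin_triangulated_category K C" "lin_triangulated_category K D"
    and "exact_functor C D F" "contra_exact_functor D (DVect K) P"
  shows "contra_exact_functor C (DVect K)
    \<lparr>onO = (\<lambda>X. onO P (onO F X)), onM = (\<lambda>f. onM P (onM F f)),
     shiso = (\<lambda>X. dcomp K (dshift K (onM P (shiso F X))) (shiso P (onO F X)))\<rparr>"
proof -
  interpret C: lin_triangulated_category K C by fact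
  interpret D: lin_triangulated_category K D by fact
  note F = exact_functorD[OF assms(3)]
  note P = contra_exact_functorD[OF assms(4), simplified DVect_simps]
  have iso: "dcomp K (dshift K (onM P (shiso F X))) (shiso P (onO F X))
      \<in> isos (DVect K) (onO P (onO F X)) (cshift (onO P (onO F (shO C X))))" if X: "X \<in> obs C" for X
    by (rule DVect.isos_comp[unfolded DVect_simps, OF P(5)[OF F(1)[OF X]] DVect_isos_shift[OF
          contra_exact_functor_isos[OF assms(4) F(1)[OF C.shO_obs[OF X]] D.shO_obs[OF F(1)[OF X]]
            F(5)[OF X]]]])
  have nat: "dcomp K (dshift K (onM P (onM F (shM C f))))
        (dcomp K (dshift K (onM P (shiso F Y))) (shiso P (onO F Y))) =
      dcomp K (dcomp K (dshift K (onM P (shiso F X))) (shiso P (onO F X))) (onM P (onM F f))"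
    if f: "f \<in> Hom C X Y" for X Y f
  proof -
    have X: "X \<in> obs C" "Y \<in> obs C" using C.Hom_obs[OF f] by auto
    note sX = X[THEN C.shO_obs] and FX = X[THEN F(1)]
    note sFX = FX[THEN D.shO_obs] and FsX = sX[THEN F(1)]
    note Ff = F(2)[OF X f] and Fsf = F(2)[OF sX C.shM_hom[OF f]]
    note sF = X[THEN F(5), THEN isosD] and sP = FX[THEN P(5), THEN isosD]
    note PsF = P(2)[OF FsX(1) sFX(1) sF(1)] P(2)[OF FsX(2) sFX(2) sF(2)]
    note PsFf = P(2)[OF sFX D.shM_hom[OF Ff]]
    have "dcomp K (dshift K (onM P (onM F (shM C f))))
          (dcomp K (dshift K (onM P (shiso F Y))) (shiso P (onO F Y))) =
        dcomp K (dshift K (dcomp K (onM P (onM F (shM C f))) (onM P (shiso F Y))))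
          (shiso P (onO F Y))"
      by (simp only: dshift_comp[OF PsF(2) P(2)[OF FsX Fsf]]
          dcomp_assoc[OF sP(2) dshift_Hom[OF PsF(2)] dshift_Hom[OF P(2)[OF FsX Fsf]]])
    \<comment> \<open>Under \<open>P\<close> composites are reversed; this is the image of the
      naturality square of \<open>shiso F\<close> at \<open>f\<close>.\<close>
    also have "dcomp K (onM P (onM F (shM C f))) (onM P (shiso F Y)) =
        dcomp K (onM P (shiso F X)) (onM P (shM D (onM F f)))"
      by (simp only: P(4)[OF FsX sFX(2) Fsf sF(2), symmetric] F(6)[OF X f]
          P(4)[OF FsX(1) sFX sF(1) D.shM_hom[OF Ff]])
    also have "dcomp K (dshift K \<dots>) (shiso P (onO F Y)) =
        dcomp K (dshift K (onM P (shiso F X)))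
          (dcomp K (dshift K (onM P (shM D (onM F f)))) (shiso P (onO F Y)))"
      by (simp only: dshift_comp[OF PsFf PsF(1)]
          dcomp_assoc[OF sP(2) dshift_Hom[OF PsFf] dshift_Hom[OF PsF(1)]])
    also have "\<dots> = dcomp K (dcomp K (dshift K (onM P (shiso F X))) (shiso P (onO F X)))
        (onM P (onM F f))"
      by (simp only: P(6)[OF FX Ff] dcomp_assoc[OF P(2)[OF FX Ff] sP(1) dshift_Hom[OF PsF(1)]])
    finally show ?thesis .
  qed
  have dist: "(onM P (onM F g), onM P (onM F f), dcomp K (dshift K (onM P (onM F h)))
      (dcomp K (dshift K (onM P (shiso F (src C f)))) (shiso P (onO F (src C f))))) \<in> dist (DVect K)"
    if fgh: "(f, g, h) \<in> dist C" for f g h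
  proof -
    obtain X Y Z where X: "X \<in> obs C" and Y: "Y \<in> obs C" and Z: "Z \<in> obs C"
      and f: "f \<in> Hom C X Y" and h: "h \<in> Hom C Z (shO C X)" "src C f = X"
      using fgh by (rule C.distE)
    note FX = F(1)[OF X] and FsX = F(1)[OF C.shO_obs[OF X]] and FZ = F(1)[OF Z]
    note sFX = D.shO_obs[OF FX]
    note Fh = F(2)[OF Z C.shO_obs[OF X] h(1)] and sF = isosD[OF F(5)[OF X]]
    note PFh = P(2)[OF FZ FsX Fh] and PsF = P(2)[OF FsX sFX sF]
    have "src D (onM F f) = onO F X"
      using F(2)[OF X Y f] by (simp add: Hom_def)
    then show ?thesis
      using P(7)[OF F(7)[OF fgh]] h(2) P(4)[OF FZ FsX sFX Fh sF] dshift_comp[OF PsF PFh]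
        dcomp_assoc[OF isosD[OF P(5)[OF FX]] dshift_Hom[OF PsF] dshift_Hom[OF PFh]]
      by simp
  qed
  have comp: "onM P (onM F (g \<cdot>\<^bsub>C\<^esub> f)) = dcomp K (onM P (onM F f)) (onM P (onM F g))"
    if fg: "f \<in> Hom C X Y" "g \<in> Hom C Y Z" for X Y Z f g
  proof -
    have X: "X \<in> obs C" "Y \<in> obs C" "Z \<in> obs C"
      using C.Hom_obs[OF fg(1)] C.Hom_obs[OF fg(2)] by auto
    show ?thesis
      unfolding F(4)[OF X fg]
      by (rule P(4)[OF F(1)[OF X(1)] F(1)[OF X(2)] F(1)[OF X(3)] F(2)[OF X(1,2) fg(1)]
            F(2)[OF X(2,3) fg(2)]])
  qed
  show ?thesis
    unfolding contra_exact_functor_def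
    using F(1-3) P(1-3) iso comp nat dist by simp
qed

section \<open>The interaction profunctor and its long exact sequences\<close>

lemma interaction_simps:
  fixes Loc \<Phi> \<Psi> a b
  defines "G \<equiv> tri_comp (Loc b) (\<Psi> b) (\<Phi> a)"
  shows "proO (interaction K Loc \<Phi> \<Psi> R a b) X Y = proO (R b) (onO G X) Y"
    and "proM (interaction K Loc \<Phi> \<Psi> R a b) f g = proM (R b) (onM G f) g"
    and "at_target (Loc b) (interaction K Loc \<Phi> \<Psi> R a b) Y =
      \<lparr>onO = (\<lambda>X. onO (at_target (Loc b) (R b) Y) (onO G X)),
       onM = (\<lambda>f. onM (at_target (Loc b) (R b) Y) (onM G f)),
       shiso = (\<lambda>X. dcomp K (dshift K (onM (at_target (Loc b) (R b) Y) (shiso G X)))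
         (shiso (at_target (Loc b) (R b) Y) (onO G X)))\<rparr>"
  by (simp_all add: interaction_def Let_def at_target_def G_def)

text \<open>Bifunctoriality constrains \<open>proO\<close> and \<open>proM\<close>, so
  \<open>Q\<close> is described through these two components; \<open>interaction\<close> alters
  \<open>proS\<close> as well.\<close>

lemma is_bifunctor_comp:
  assumes P: "is_bifunctor D C' E P" and F: "exact_functor C D F"
    and "\<And>X Y. proO Q X Y = proO P (onO F X) Y" "\<And>f g. proM Q f g = proM P (onM F f) g"
  shows "is_bifunctor C C' E Q"
proof -
  note F' = exact_functorD[OF F]
  have comp: "proM P (f' \<cdot>\<^bsub>D\<^esub> f) (g' \<cdot>\<^bsub>C'\<^esub> g) = proM P f g' \<cdot>\<^bsub>E\<^esub> proM P f' g"
    if "X \<in> obs D" "X' \<in> obs D" "X'' \<in> obs D" "Y \<in> obs C'" "Y' \<in> obs C'" "Y'' \<in> obs C'"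
      "f \<in> Hom D X X'" "f' \<in> Hom D X' X''" "g \<in> Hom C' Y Y'" "g' \<in> Hom C' Y' Y''"
    for X X' X'' Y Y' Y'' f f' g g'
    using P that unfolding is_bifunctor_def by blast
  have "proM P (onM F (f' \<cdot>\<^bsub>C\<^esub> f)) (g' \<cdot>\<^bsub>C'\<^esub> g) =
      proM P (onM F f) g' \<cdot>\<^bsub>E\<^esub> proM P (onM F f') g"
    if X: "X \<in> obs C" "X' \<in> obs C" "X'' \<in> obs C" and Y: "Y \<in> obs C'" "Y' \<in> obs C'" "Y'' \<in> obs C'"
      and f: "f \<in> Hom C X X'" "f' \<in> Hom C X' X''" and g: "g \<in> Hom C' Y Y'" "g' \<in> Hom C' Y' Y''"
    for X X' X'' Y Y' Y'' f f' g g'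
    unfolding F'(4)[OF X f]
    by (rule comp[OF X[THEN F'(1)] Y F'(2)[OF X(1,2) f(1)] F'(2)[OF X(2,3) f(2)] g])
  then show ?thesis
    using P F'(1-3) by (simp add: is_bifunctor_def assms(3,4))
qed

text \<open>\<open>contra_exact_functor\<close> places the comparison at \<open>src C f\<close>.
  Naming the vertices replaces this by \<open>X'\<close> and gives the connecting arrow the type
  which \<open>DVect_dist_long_exact\<close> asks for.\<close>

lemma contra_exact_long_exact:
  assumes "contra_exact_functor C (DVect K) F" "X' \<in> obs C" "X \<in> obs C" "X'' \<in> obs C"
    "shO C X' \<in> obs C" "f \<in> Hom C X' X" "g \<in> Hom C X X''" "h \<in> Hom C X'' (shO C X')"
    "(f, g, h) \<in> dist C"
  defines "c \<equiv> dcomp K (dshift K (onM F h)) (shiso F X')"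
  shows "c \<in> Hom (DVect K) (onO F X') (cshift (onO F X''))"
    and "(onM F g, onM F f, c) \<in> dist (DVect K)"
    and "long_exact K (onO F X'') (onO F X) (onO F X') (onM F g) (onM F f) c"
proof -
  note F = contra_exact_functorD[OF assms(1), simplified DVect_simps]
  show c: "c \<in> Hom (DVect K) (onO F X') (cshift (onO F X''))"
    unfolding c_def by (rule dcomp_Hom[OF isosD[OF F(5)[OF assms(2)]]
          dshift_Hom[OF F(2)[OF assms(4,5,8)]]])
  show dist: "(onM F g, onM F f, c) \<in> dist (DVect K)"
    using F(7)[OF assms(9)] assms(6) by (simp add: c_def Hom_def)
  show "long_exact K (onO F X'') (onO F X) (onO F X') (onM F g) (onM F f) c"
    by (rule DVect_dist_long_exact[OF dist F(2)[OF assms(3,4,7)] F(2)[OF assms(2,3,6)] c])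
qed

theorem theorem1p3:
  fixes K :: "'k ring" and r :: nat and p :: "nat \<Rightarrow> 'p"
    and Bulk :: "('k, 'bo, 'bm) lin_category"
    and Loc :: "'p \<Rightarrow> ('k, 'o, 'm) lin_category"
    and \<Phi> :: "'p \<Rightarrow> ('o, 'm, 'bo, 'bm) tri_functor"
    and \<Psi> :: "'p \<Rightarrow> ('bo, 'bm, 'o, 'm) tri_functor"
    and L :: "'p \<Rightarrow> 'o"
    and R :: "'p \<Rightarrow> ('k, 'u, 'o, 'm) derived_hom"
    and i j :: nat
  assumes "mtt_datum K r p Bulk Loc \<Phi> \<Psi> L R"
    and "1 \<le> i" "i \<le> r" "1 \<le> j" "j \<le> r"
  shows "let Ci = Loc (p i);
             Cj = Loc (p j);
             D = DVect K;
             T = interaction K Loc \<Phi> \<Psi> R (p i) (p j)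
         in is_bifunctor Ci Cj D T \<and>
            (\<forall>Y \<in> obs Cj. contra_exact_functor Ci D (at_target Cj T Y)) \<and>
            (\<forall>Y \<in> obs Cj. \<forall>X' \<in> obs Ci. \<forall>X \<in> obs Ci. \<forall>X'' \<in> obs Ci.
               \<forall>f \<in> Hom Ci X' X. \<forall>g \<in> Hom Ci X X''. \<forall>h \<in> Hom Ci X'' (shO Ci X').
               (f, g, h) \<in> dist Ci \<longrightarrow>
               (let a = proM T g (ide Cj Y);
                    b = proM T f (ide Cj Y);
                    c = shM D (proM T h (ide Cj Y)) \<cdot>\<^bsub>D\<^esub> proS T X' Y
                in a \<in> Hom D (proO T X'' Y) (proO T X Y) \<and>
                   b \<in> Hom D (proO T X Y) (proO T X' Y) \<and>
                   c \<in> Hom D (proO T X' Y) (shO D (proO T X'' Y)) \<and>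
                   (a, b, c) \<in> dist D \<and>
                   long_exact K (proO T X'' Y) (proO T X Y) (proO T X' Y) a b c))"
proof -
  interpret mtt_datum K r p Bulk Loc \<Phi> \<Psi> L R by fact
  define Ci Cj T where "Ci = Loc (p i)" and "Cj = Loc (p j)"
    and "T = interaction K Loc \<Phi> \<Psi> R (p i) (p j)"
  have ij: "i \<in> {1..r}" "j \<in> {1..r}"
    using assms(2-5) by auto
  interpret Ci: lin_triangulated_category K Ci
    unfolding Ci_def by (rule localized[OF ij(1)])
  interpret Cj: lin_triangulated_category K Cj
    unfolding Cj_def by (rule localized[OF ij(2)])
  interpret derived_hom K Cj "R (p j)"
    unfolding Cj_def by (rule rhom[OF ij(2)])
  have G: "exact_functor Ci Cj (tri_comp Cj (\<Psi> (p j)) (\<Phi> (p i)))"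
    unfolding Ci_def Cj_def
    using exact_functor_comp[OF localized[OF ij(1)] bulk localized[OF ij(2)] \<Phi>_exact[OF ij(1)]
        \<Psi>_exact[OF ij(2)]] .
  have bif: "is_bifunctor Ci Cj (DVect K) T"
    by (rule is_bifunctor_comp[OF bifunctor G]) (simp_all add: T_def Cj_def interaction_simps)
  have exact: "contra_exact_functor Ci (DVect K) (at_target Cj T Y)" if "Y \<in> obs Cj" for Y
    \<comment> \<open>After unfolding, the functor is the composite record of
      \<open>contra_exact_functor_comp\<close>, with RHom(-, Y) as \<open>P\<close> and the
      composite of \<open>\<Psi>\<close> and \<open>\<Phi>\<close> as \<open>F\<close>.\<close>
    unfolding T_def Cj_def interaction_simps
    using contra_exact_functor_comp[OF Ci.lin_triangulated_category_axioms
        Cj.lin_triangulated_category_axioms G exact_source[OF that]]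
    by (simp add: Cj_def)
  show ?thesis
    unfolding Let_def Ci_def[symmetric] Cj_def[symmetric] T_def[symmetric] DVect_simps
  proof (intro conjI ballI impI bif exact)
    fix Y X' X X'' f g h
    assume *: "Y \<in> obs Cj" "X' \<in> obs Ci" "X \<in> obs Ci" "X'' \<in> obs Ci" "f \<in> Hom Ci X' X"
      "g \<in> Hom Ci X X''" "h \<in> Hom Ci X'' (shO Ci X')" "(f, g, h) \<in> dist Ci"
    note E = exact[OF *(1)]
    note les = contra_exact_long_exact[OF E *(2-4) Ci.shO_obs[OF *(2)] *(5-8)]
    show "proM T g (ide Cj Y) \<in> Hom (DVect K) (proO T X'' Y) (proO T X Y)"
      using contra_exact_functorD(2)[OF E *(3,4,6)] by (simp add: at_target_def)
    show "proM T f (ide Cj Y) \<in> Hom (DVect K) (proO T X Y) (proO T X' Y)"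
      using contra_exact_functorD(2)[OF E *(2,3,5)] by (simp add: at_target_def)
    show "dcomp K (dshift K (proM T h (ide Cj Y))) (proS T X' Y)
        \<in> Hom (DVect K) (proO T X' Y) (cshift (proO T X'' Y))"
      using les(1) by (simp add: at_target_def)
    show "(proM T g (ide Cj Y), proM T f (ide Cj Y),
        dcomp K (dshift K (proM T h (ide Cj Y))) (proS T X' Y)) \<in> dist (DVect K)"
      using les(2) by (simp add: at_target_def)
    show "long_exact K (proO T X'' Y) (proO T X Y) (proO T X' Y) (proM T g (ide Cj Y))
        (proM T f (ide Cj Y)) (dcomp K (dshift K (proM T h (ide Cj Y))) (proS T X' Y))"
      using les(3) by (simp add: at_target_def)
  qed
qed

end
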